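(* Let $N\ge 1$ be an integer, let $p>q\ge N$ with $q>1$, and let $u$ be any nontrivial non-negative solution of $$-\Delta_p u-\Delta_q u\ge 0\quad\text{in }\mathbb R^N .$$ Then $u$ is constant.
   Context: For $r>1$, $\Delta_r u=\operatorname{div}(|\nabla u|^{r-2}\nabla u)$. A non-negative solution of $-\Delta_p u-\Delta_q u\ge 0$ in an open set $\Omega$ is a function $u\in C(\Omega)\cap W^{1,p}_{loc}(\Omega)$, $u\ge 0$, such that $$\int_\Omega |\nabla u|^{p-2}\nabla u\cdot\nabla\varphi\,dx+\int_\Omega |\nabla u|^{q-2}\nabla u\cdot\nabla\varphi\,dx\ge 0\quad\text{for all }\varphi\in C^1_c(\Omega),\ \varphi\ge 0.$$ "Nontrivial" means not identically zero. *)

theory Defs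
  imports "HOL-Analysis.Analysis"
begin

definition grad :: "('a::euclidean_space \<Rightarrow> real) \<Rightarrow> 'a \<Rightarrow> 'a" where
  "grad f x = (\<Sum>b\<in>Basis. frechet_derivative f (at x) b *\<^sub>R b)"

lemma GDERIV_grad:
  assumes "f differentiable (at x)"
  shows "GDERIV f x :> grad f x"
proof -
  let ?D = "frechet_derivative f (at x)"
  have D: "(f has_derivative ?D) (at x)"
    using assms frechet_derivative_works by blast
  then have lin: "linear ?D"
    by (rule has_derivative_linear)
  have "?D h = h \<bullet> grad f x" for h
  proof -
    have "?D h = ?D (\<Sum>b\<in>Basis. (h \<bullet> b) *\<^sub>R b)"
      by (simp add: euclidean_representation)
    also have "\<dots> = (\<Sum>b\<in>Basis. (h \<bullet> b) * ?D b)"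
      using lin by (simp add: linear_sum linear_cmul)
    also have "\<dots> = h \<bullet> grad f x"
      by (simp add: grad_def inner_sum_right mult.commute)
    finally show ?thesis .
  qed
  then have "?D = (\<lambda>h. h \<bullet> grad f x)"
    by blast
  with D show ?thesis
    by (simp add: gderiv_def)
qed

text \<open>An element of \<open>C1c \<Omega>\<close> is represented by its extension by zero to the whole space.\<close>

definition C1c :: "'a::euclidean_space set \<Rightarrow> ('a \<Rightarrow> real) set" where
  "C1c \<Omega> = {\<phi>. (\<forall>x. \<phi> differentiable (at x)) \<and> continuous_on UNIV (grad \<phi>) \<and>
     compact (closure {x. \<phi> x \<noteq> 0}) \<and> closure {x. \<phi> x \<noteq> 0} \<subseteq> \<Omega>}"

definition Lp_loc ::
  "'a::euclidean_space set \<Rightarrow> real \<Rightarrow> ('a \<Rightarrow> 'b::euclidean_space) set" where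
  "Lp_loc \<Omega> p = {f. f \<in> borel_measurable (lebesgue_on \<Omega>) \<and>
     (\<forall>K. compact K \<and> K \<subseteq> \<Omega> \<longrightarrow> set_integrable lebesgue K (\<lambda>x. norm (f x) powr p))}"

text \<open>The local integrability conditions are needed because the Bochner integral of a
  non-integrable function is 0. Testing against \<open>C1c\<close> functions gives the same weak
  derivatives as testing against smooth ones, by mollification.\<close>

definition has_weak_gradient ::
  "'a::euclidean_space set \<Rightarrow> ('a \<Rightarrow> real) \<Rightarrow> ('a \<Rightarrow> 'a) \<Rightarrow> bool" where
  "has_weak_gradient \<Omega> u G \<longleftrightarrow> u \<in> Lp_loc \<Omega> 1 \<and> G \<in> Lp_loc \<Omega> 1 \<and>
     (\<forall>\<phi>\<in>C1c \<Omega>. \<forall>b\<in>Basis.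
        (LINT x:\<Omega>|lebesgue. u x * (grad \<phi> x \<bullet> b)) = - (LINT x:\<Omega>|lebesgue. (G x \<bullet> b) * \<phi> x))"

definition W1p_loc :: "'a::euclidean_space set \<Rightarrow> real \<Rightarrow> ('a \<Rightarrow> real) set" where
  "W1p_loc \<Omega> p = {u. u \<in> Lp_loc \<Omega> p \<and> (\<exists>G\<in>Lp_loc \<Omega> p. has_weak_gradient \<Omega> u G)}"

text \<open>Since \<open>0 powr s = 0\<close>, the field \<open>norm v powr (r - 2) *\<^sub>R v\<close> vanishes at \<open>v = 0\<close> for
  every \<open>r\<close>, which is its continuous value for \<open>r > 1\<close>. Weak gradients are unique up to null
  sets, so in the definition of a solution it does not matter which \<open>G\<close> is taken.\<close>

definition nonneg_supersolution ::
  "'a::euclidean_space set \<Rightarrow> real \<Rightarrow> real \<Rightarrow> ('a \<Rightarrow> real) \<Rightarrow> bool" where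
  "nonneg_supersolution \<Omega> p q u \<longleftrightarrow> open \<Omega> \<and> continuous_on \<Omega> u \<and> u \<in> W1p_loc \<Omega> p \<and>
     (\<forall>x\<in>\<Omega>. u x \<ge> 0) \<and>
     (\<exists>G\<in>Lp_loc \<Omega> p. has_weak_gradient \<Omega> u G \<and>
        (\<forall>\<phi>\<in>C1c \<Omega>. (\<forall>x\<in>\<Omega>. \<phi> x \<ge> 0) \<longrightarrow>
           (LINT x:\<Omega>|lebesgue. (norm (G x) powr (p - 2) *\<^sub>R G x) \<bullet> grad \<phi> x)
         + (LINT x:\<Omega>|lebesgue. (norm (G x) powr (q - 2) *\<^sub>R G x) \<bullet> grad \<phi> x) \<ge> 0))"

end

theory Submission
  imports Defs
begin

text \<open>
  Write \<open>w = u + 1 \<ge> 1\<close> and test the inequality with the \<open>n\<close>-th power of \<open>v = \<psi> / w\<close>, where \<open>\<psi>\<close> is a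
  cutoff function with values between \<open>0\<close> and \<open>1\<close> and \<open>n > p\<close>. Since
  \<open>\<nabla> (v\<^sup>n) = n (v ^ (n - 1) \<nabla>\<psi> / w - v\<^sup>n \<nabla>u / w)\<close>, this gives
  \<open>\<integral> (\<bar>\<nabla>u\<bar>\<^sup>p + \<bar>\<nabla>u\<bar>\<^sup>q) v\<^sup>n / w \<le> \<integral> (\<bar>\<nabla>u\<bar> ^ (p - 1) + \<bar>\<nabla>u\<bar> ^ (q - 1)) v ^ (n - 1) \<bar>\<nabla>\<psi>\<bar> / w\<close>.
  Young's inequality for \<open>\<bar>\<nabla>u\<bar> v\<close> and \<open>\<bar>\<nabla>\<psi>\<bar>\<close> absorbs the right-hand side; the factors \<open>v ^ (n - p)\<close>,
  \<open>v ^ (n - q)\<close> and \<open>1 / w\<close> are at most \<open>1\<close> and disappear from the error. What remains is a Caccioppoli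
  estimate (\<open>caccioppoli\<close>) whose right-hand side is a constant times
  \<open>\<integral> \<bar>\<nabla>\<psi>\<bar>\<^sup>p + \<integral> \<bar>\<nabla>\<psi>\<bar>\<^sup>q\<close> and does not involve \<open>u\<close>.

  Both exponents are at least the dimension and greater than \<open>1\<close>. A logarithmic cutoff, which is
  the average of \<open>m\<close> dyadic rescalings of one cutoff function, therefore has energy of order
  \<open>m powr (1 - q)\<close> at most, although it equals \<open>1\<close> on balls of radius \<open>2 ^ m\<close>
  (\<open>integral_grad_log_cutoff_le\<close>). Letting \<open>m\<close> tend to infinity yields \<open>\<nabla>u = 0\<close> almost everywhere
  (\<open>gradient_eq_0\<close>), and \<open>u\<close> is constant because its mollifications are.

  The power of \<open>v\<close> is not continuously differentiable, so it is an admissible test function only after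
  \<open>u\<close> has been mollified. Passing to the limit in \<open>test_quotient_inequality\<close> requires that
  the mollified gradient converges to \<open>\<nabla>u\<close> when integrated against the flux, whose size is
  \<open>\<bar>\<nabla>u\<bar> ^ (p - 1) + \<bar>\<nabla>u\<bar> ^ (q - 1)\<close>. This follows from the continuity of translations in \<open>L\<^sup>1\<close> by truncating
  large gradients (\<open>powr_weighted_translation_continuous\<close>).
\<close>

section \<open>Continuity of translations in mean\<close>

lemma nn_integral_lborel_affine_isometry:
  fixes a :: "'a::euclidean_space" and f :: "'a \<Rightarrow> ennreal"
  assumes [measurable]: "f \<in> borel_measurable borel" and c: "\<bar>c\<bar> = 1"
  shows "(\<integral>\<^sup>+x. f (a + c *\<^sub>R x) \<partial>lborel) = (\<integral>\<^sup>+x. f x \<partial>lborel)"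
proof -
  have "lborel = distr lborel borel (\<lambda>x. a + c *\<^sub>R x)"
    using lborel_affine[of c a] c by (auto simp: density_1)
  then have "(\<integral>\<^sup>+x. f x \<partial>lborel) = (\<integral>\<^sup>+x. f x \<partial>distr lborel borel (\<lambda>x. a + c *\<^sub>R x))"
    by simp
  also have "\<dots> = (\<integral>\<^sup>+x. f (a + c *\<^sub>R x) \<partial>lborel)"
    by (subst nn_integral_distr) auto
  finally show ?thesis by simp
qed

lemma integral_lborel_affine_isometry:
  fixes a :: "'a::euclidean_space" and f :: "'a \<Rightarrow> 'b::euclidean_space"
  assumes [measurable]: "f \<in> borel_measurable borel" and c: "\<bar>c\<bar> = 1"
  shows "(\<integral>x. f (a + c *\<^sub>R x) \<partial>lborel) = (\<integral>x. f x \<partial>lborel)"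
    and "integrable lborel (\<lambda>x. f (a + c *\<^sub>R x)) \<longleftrightarrow> integrable lborel f"
proof -
  have *: "distr lborel borel (\<lambda>x. a + c *\<^sub>R x) = lborel"
    using lborel_affine[of c a] c by (auto simp: density_1)
  show "(\<integral>x. f (a + c *\<^sub>R x) \<partial>lborel) = (\<integral>x. f x \<partial>lborel)"
    by (subst (2) *[symmetric], subst integral_distr) auto
  show "integrable lborel (\<lambda>x. f (a + c *\<^sub>R x)) \<longleftrightarrow> integrable lborel f"
    by (subst (2) *[symmetric], subst integrable_distr_eq) auto
qed

text \<open>The integral is a nonnegative one so that no integrability has to be carried along.\<close>

definition L1_translation_continuous :: "('a::euclidean_space \<Rightarrow> 'b::euclidean_space) \<Rightarrow> bool" where
  "L1_translation_continuous f \<longleftrightarrow>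
     (\<forall>e>0. \<exists>d>0. \<forall>y. norm y < d \<longrightarrow> (\<integral>\<^sup>+x. norm (f (x + y) - f x) \<partial>lborel) \<le> ennreal e)"

text \<open>The property survives \<open>L\<^sup>1\<close> limits by a three-epsilon argument: translation
  invariance makes the errors at \<open>x\<close> and at \<open>x + y\<close> equal in the mean.\<close>

lemma L1_translation_continuous_approx:
  fixes f :: "'a::euclidean_space \<Rightarrow> 'b::euclidean_space"
  assumes f[measurable]: "f \<in> borel_measurable borel"
    and approx: "\<And>e. e > 0 \<Longrightarrow> \<exists>g\<in>borel_measurable borel. L1_translation_continuous g
      \<and> (\<integral>\<^sup>+x. norm (f x - g x) \<partial>lborel) \<le> ennreal e"
  shows "L1_translation_continuous f"
  unfolding L1_translation_continuous_def
proof (intro allI impI)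
  fix e :: real assume "e > 0"
  then obtain g where [measurable]: "g \<in> borel_measurable borel" and g: "L1_translation_continuous g"
    and fg: "(\<integral>\<^sup>+x. norm (f x - g x) \<partial>lborel) \<le> ennreal (e/3)"
    using approx[of "e/3"] by auto
  obtain d where d: "d > 0"
    "\<And>y. norm y < d \<Longrightarrow> (\<integral>\<^sup>+x. norm (g (x + y) - g x) \<partial>lborel) \<le> ennreal (e/3)"
    using g \<open>e > 0\<close> unfolding L1_translation_continuous_def by (meson divide_pos_pos zero_less_numeral)
  have "(\<integral>\<^sup>+x. norm (f (x + y) - f x) \<partial>lborel) \<le> ennreal e" if y: "norm y < d" for y
  proof -
    have "(\<integral>\<^sup>+x. norm (f (x + y) - f x) \<partial>lborel) \<le>
      (\<integral>\<^sup>+x. (ennreal (norm (f (x + y) - g (x + y))) + ennreal (norm (g (x + y) - g x)))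
         + ennreal (norm (f x - g x)) \<partial>lborel)"
    proof (intro nn_integral_mono)
      fix x
      have "norm (f (x + y) - f x) \<le> norm (f (x + y) - g (x + y)) + norm (g (x + y) - g x) + norm (f x - g x)"
        by norm
      then show "ennreal (norm (f (x + y) - f x)) \<le> (ennreal (norm (f (x + y) - g (x + y)))
          + ennreal (norm (g (x + y) - g x))) + ennreal (norm (f x - g x))"
        by (simp flip: ennreal_plus)
    qed
    also have "\<dots> = (\<integral>\<^sup>+x. norm (f (x + y) - g (x + y)) \<partial>lborel) + (\<integral>\<^sup>+x. norm (g (x + y) - g x) \<partial>lborel)
         + (\<integral>\<^sup>+x. norm (f x - g x) \<partial>lborel)"
      by (simp add: nn_integral_add)
    also have "(\<integral>\<^sup>+x. norm (f (x + y) - g (x + y)) \<partial>lborel) = (\<integral>\<^sup>+x. norm (f x - g x) \<partial>lborel)"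
      using nn_integral_lborel_affine_isometry[of "\<lambda>x. ennreal (norm (f x - g x))" 1 y] by (simp add: add.commute)
    also have "(\<integral>\<^sup>+x. norm (f x - g x) \<partial>lborel) + (\<integral>\<^sup>+x. norm (g (x + y) - g x) \<partial>lborel)
         + (\<integral>\<^sup>+x. norm (f x - g x) \<partial>lborel) \<le> ennreal (e/3) + ennreal (e/3) + ennreal (e/3)"
      using fg d(2)[OF y] by (intro add_mono)
    also have "\<dots> = ennreal e"
      using \<open>e > 0\<close> by (simp flip: ennreal_plus)
    finally show ?thesis .
  qed
  then show "\<exists>d>0. \<forall>y. norm y < d \<longrightarrow> (\<integral>\<^sup>+x. norm (f (x + y) - f x) \<partial>lborel) \<le> ennreal e"
    using d(1) by blast
qed

text \<open>The symmetric difference of \<open>U\<close> and its translate consists of the points that leave \<open>U\<close> under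
  the shift by \<open>y\<close> and of a translate of the points that leave \<open>U\<close> under the shift by \<open>- y\<close>.
  Each point of an open set stays in it for small shifts, so both measures tend to \<open>0\<close> by
  dominated convergence.\<close>

lemma L1_translation_continuous_indicator_open:
  fixes U :: "'a::euclidean_space set" and c :: "'b::euclidean_space"
  assumes U: "open U" and fin: "emeasure lborel U < \<infinity>"
  shows "L1_translation_continuous (\<lambda>x. indicator U x *\<^sub>R c)"
proof -
  \<comment> \<open>\<open>h y\<close> is the indicator of the points of \<open>U\<close> that the shift by \<open>y\<close> takes out of \<open>U\<close>.\<close>
  define h where "h y x = indicator U x * (1 - indicator U (x + y) :: real)" for x y :: 'a
  have [measurable]: "U \<in> sets borel" using U by auto
  have intU: "integrable lborel (indicator U :: 'a \<Rightarrow> real)"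
    using fin by (simp add: integrable_indicator_iff)
  have hm[measurable]: "h y \<in> borel_measurable borel" for y
    unfolding h_def by measurable
  have hbd: "norm (h y x) \<le> indicator U x" and h0: "0 \<le> h y x" for x y
    by (auto simp: h_def indicator_def)
  have inth: "integrable lborel (h y)" for y
    by (rule Bochner_Integration.integrable_bound[OF intU]) (use hbd in auto)
  have "isCont (\<lambda>y. \<integral>x. h y x \<partial>lborel) 0"
    unfolding continuous_at_sequentially
  proof (intro allI impI)
    fix Y :: "nat \<Rightarrow> 'a" assume Y: "Y \<longlonglongrightarrow> 0"
    have "(\<lambda>n. \<integral>x. h (Y n) x \<partial>lborel) \<longlonglongrightarrow> (\<integral>x. h 0 x \<partial>lborel)"
    proof (rule integral_dominated_convergence[where w="indicator U"])
      show "AE x in lborel. (\<lambda>n. h (Y n) x) \<longlonglongrightarrow> h 0 x"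
      proof (rule AE_I2)
        fix x
        show "(\<lambda>n. h (Y n) x) \<longlonglongrightarrow> h 0 x"
        proof (cases "x \<in> U")
          case True
          have "(\<lambda>n. x + Y n) \<longlonglongrightarrow> x + 0" by (intro tendsto_intros Y)
          then have "\<forall>\<^sub>F n in sequentially. x + Y n \<in> U"
            using topological_tendstoD[OF _ U, of _ "x + 0"] True by simp
          then have "\<forall>\<^sub>F n in sequentially. h (Y n) x = h 0 x"
            by eventually_elim (use True in \<open>auto simp: h_def\<close>)
          then show ?thesis by (rule tendsto_eventually)
        qed (simp add: h_def)
      qed
    qed (use hbd intU in auto)
    then show "((\<lambda>y. \<integral>x. h y x \<partial>lborel) \<circ> Y) \<longlonglongrightarrow> (\<integral>x. h 0 x \<partial>lborel)"
      by (simp add: o_def)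
  qed
  moreover have "h 0 = (\<lambda>_. 0)" by (auto simp: h_def indicator_def fun_eq_iff)
  ultimately have cont: "\<forall>e>0. \<exists>d>0. \<forall>y. norm y < d \<longrightarrow> \<bar>\<integral>x. h y x \<partial>lborel\<bar> < e"
    unfolding continuous_at_eps_delta by (simp add: dist_norm)
  show ?thesis
    unfolding L1_translation_continuous_def
  proof (intro allI impI)
    fix e :: real assume "e > 0"
    define e' where "e' = e / (2 * (norm c + 1))"
    have "e' > 0" using \<open>e > 0\<close> by (simp add: e'_def add_nonneg_pos)
    then obtain d where d: "d > 0" "\<And>y. norm y < d \<Longrightarrow> \<bar>\<integral>x. h y x \<partial>lborel\<bar> < e'"
      using cont by blast
    have le: "(\<integral>\<^sup>+x. h y x \<partial>lborel) \<le> ennreal e'" if "norm y < d" for y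
      using less_imp_le[OF d(2)[OF that]] h0 inth by (subst nn_integral_eq_integral) (auto intro!: ennreal_leI)
    have "(\<integral>\<^sup>+x. norm (indicator U (x + y) *\<^sub>R c - indicator U x *\<^sub>R c) \<partial>lborel) \<le> ennreal e"
      if y: "norm y < d" for y
    proof -
      have "(\<integral>\<^sup>+x. norm (indicator U (x + y) *\<^sub>R c - indicator U x *\<^sub>R c) \<partial>lborel)
          = (\<integral>\<^sup>+x. ennreal (norm c) * (ennreal (h y x) + ennreal (h (-y) (x + y))) \<partial>lborel)"
        by (intro nn_integral_cong)
           (auto simp: h_def indicator_def simp flip: ennreal_plus ennreal_mult)
      also have "\<dots> = ennreal (norm c) * ((\<integral>\<^sup>+x. h y x \<partial>lborel) + (\<integral>\<^sup>+x. h (-y) (x + y) \<partial>lborel))"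
        by (simp add: nn_integral_cmult nn_integral_add)
      also have "(\<integral>\<^sup>+x. h (-y) (x + y) \<partial>lborel) = (\<integral>\<^sup>+x. h (-y) x \<partial>lborel)"
        using nn_integral_lborel_affine_isometry[of "\<lambda>x. ennreal (h (-y) x)" 1 y] by (simp add: add.commute)
      also have "ennreal (norm c) * ((\<integral>\<^sup>+x. h y x \<partial>lborel) + (\<integral>\<^sup>+x. h (-y) x \<partial>lborel))
          \<le> ennreal (norm c) * (ennreal e' + ennreal e')"
        using le[of y] le[of "-y"] y by (intro mult_left_mono add_mono) auto
      also have "\<dots> = ennreal (norm c * (2 * e'))"
        using \<open>e' > 0\<close> by (simp flip: ennreal_plus ennreal_mult)
      also have "norm c * (2 * e') \<le> e"
      proof -
        have "norm c * (2 * e') \<le> (norm c + 1) * (2 * e')" using \<open>e' > 0\<close> by (intro mult_right_mono) auto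
        also have "norm c + 1 \<noteq> 0" using norm_ge_zero[of c] by linarith
        then have "(norm c + 1) * (2 * e') = e" by (simp add: e'_def del: distrib_left_numeral)
        finally show ?thesis .
      qed
      finally show ?thesis by (simp add: ennreal_leI)
    qed
    then show "\<exists>d>0. \<forall>y. norm y < d \<longrightarrow>
        (\<integral>\<^sup>+x. norm (indicator U (x + y) *\<^sub>R c - indicator U x *\<^sub>R c) \<partial>lborel) \<le> ennreal e"
      using d(1) by blast
  qed
qed

text \<open>Outer regularity passes from open sets to Borel sets of finite measure, and the induction
  principle for integrable functions does the rest.\<close>

theorem L1_translation_continuous:
  fixes f :: "'a::euclidean_space \<Rightarrow> 'b::euclidean_space"
  assumes "integrable lborel f"
  shows "L1_translation_continuous f"
  using assms
proof (induction rule: integrable_induct)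
  case (base A c)
  show ?case
  proof (rule L1_translation_continuous_approx)
    have A[measurable]: "A \<in> sets borel" using base by simp
    fix e :: real assume "e > 0"
    define e' where "e' = e / (norm c + 1)"
    have "e' > 0" using \<open>e > 0\<close> by (simp add: e'_def add_nonneg_pos)
    obtain U where U: "open U" "A \<subseteq> U" "emeasure lborel (U - A) < e'"
      using outer_regular_lborel[OF A \<open>e' > 0\<close>] by auto
    have Um[measurable]: "U \<in> sets borel" using U by auto
    have "emeasure lborel U \<le> emeasure lborel A + emeasure lborel (U - A)"
      using U(2) by (subst plus_emeasure) (auto intro!: emeasure_mono)
    also have "\<dots> < \<infinity>" using U(3) base(2) by (auto simp: less_top[symmetric])
    finally have "L1_translation_continuous (\<lambda>x. indicator U x *\<^sub>R c)"
      by (intro L1_translation_continuous_indicator_open U(1))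
    moreover have "(\<integral>\<^sup>+x. norm (indicator A x *\<^sub>R c - indicator U x *\<^sub>R c) \<partial>lborel) \<le> ennreal e"
    proof -
      have "(\<integral>\<^sup>+x. norm (indicator A x *\<^sub>R c - indicator U x *\<^sub>R c) \<partial>lborel)
          = (\<integral>\<^sup>+x. ennreal (norm c) * indicator (U - A) x \<partial>lborel)"
        using U(2) by (intro nn_integral_cong) (auto simp: indicator_def)
      also have "\<dots> = ennreal (norm c) * emeasure lborel (U - A)"
        by (simp add: nn_integral_cmult_indicator)
      also have "\<dots> \<le> ennreal (norm c) * ennreal e'"
        using U(3) by (intro mult_left_mono) auto
      also have "\<dots> = ennreal (norm c * e')" using \<open>e' > 0\<close> by (simp flip: ennreal_mult)
      also have "norm c * e' \<le> e"
      proof -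
        have "norm c * e' \<le> (norm c + 1) * e'" using \<open>e' > 0\<close> by (intro mult_right_mono) auto
        also have "norm c + 1 > 0" by (simp add: add_nonneg_pos)
        then have "(norm c + 1) * e' = e" by (simp add: e'_def)
        finally show ?thesis .
      qed
      finally show ?thesis by (simp add: ennreal_leI)
    qed
    ultimately show "\<exists>g\<in>borel_measurable borel. L1_translation_continuous g \<and>
        (\<integral>\<^sup>+x. norm (indicator A x *\<^sub>R c - g x) \<partial>lborel) \<le> ennreal e"
      by (intro bexI[of _ "\<lambda>x. indicator U x *\<^sub>R c"]) auto
  qed (use base in auto)
next
  case (add f g)
  have [measurable]: "f \<in> borel_measurable borel" "g \<in> borel_measurable borel"
    using add by (auto dest: borel_measurable_integrable)
  show ?case
    unfolding L1_translation_continuous_def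
  proof (intro allI impI)
    fix e :: real assume "e > 0"
    then have "e/2 > 0" by simp
    obtain d where d: "d > 0" "\<And>y. norm y < d \<Longrightarrow> (\<integral>\<^sup>+x. norm (f (x + y) - f x) \<partial>lborel) \<le> ennreal (e/2)"
      using add.IH(1) \<open>e/2 > 0\<close> unfolding L1_translation_continuous_def by meson
    obtain d' where d': "d' > 0" "\<And>y. norm y < d' \<Longrightarrow> (\<integral>\<^sup>+x. norm (g (x + y) - g x) \<partial>lborel) \<le> ennreal (e/2)"
      using add.IH(2) \<open>e/2 > 0\<close> unfolding L1_translation_continuous_def by meson
    have "(\<integral>\<^sup>+x. norm (f (x + y) + g (x + y) - (f x + g x)) \<partial>lborel) \<le> ennreal e"
      if "norm y < min d d'" for y
    proof -
      have "(\<integral>\<^sup>+x. norm (f (x + y) + g (x + y) - (f x + g x)) \<partial>lborel)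
        \<le> (\<integral>\<^sup>+x. ennreal (norm (f (x + y) - f x)) + ennreal (norm (g (x + y) - g x)) \<partial>lborel)"
      proof (intro nn_integral_mono)
        fix x
        have "norm (f (x + y) + g (x + y) - (f x + g x)) \<le> norm (f (x + y) - f x) + norm (g (x + y) - g x)"
          by norm
        then show "ennreal (norm (f (x + y) + g (x + y) - (f x + g x)))
            \<le> ennreal (norm (f (x + y) - f x)) + ennreal (norm (g (x + y) - g x))"
          by (simp flip: ennreal_plus)
      qed
      also have "\<dots> \<le> ennreal (e/2) + ennreal (e/2)"
        using d(2)[of y] d'(2)[of y] that by (auto simp: nn_integral_add intro!: add_mono)
      also have "\<dots> = ennreal e" using \<open>e > 0\<close> by (simp flip: ennreal_plus)
      finally show ?thesis .
    qed
    then show "\<exists>d>0. \<forall>y. norm y < d \<longrightarrow> (\<integral>\<^sup>+x. norm (f (x + y) + g (x + y) - (f x + g x)) \<partial>lborel) \<le> ennreal e"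
      using d(1) d'(1) by (intro exI[of _ "min d d'"]) auto
  qed
next
  case (lim f s)
  show ?case
  proof (rule L1_translation_continuous_approx)
    show "f \<in> borel_measurable borel" using lim.hyps by (auto dest: borel_measurable_integrable)
    fix e :: real assume "e > 0"
    have [measurable]: "f \<in> borel_measurable borel" "s i \<in> borel_measurable borel" for i
      using lim.hyps by (auto dest: borel_measurable_integrable)
    have "(\<lambda>i. \<integral>\<^sup>+x. norm (f x - s i x) \<partial>lborel) \<longlonglongrightarrow> (\<integral>\<^sup>+x. 0 \<partial>(lborel::'a measure))"
    proof (rule nn_integral_dominated_convergence[where w="\<lambda>x. ennreal (3 * norm (f x))"])
      show "AE x in lborel. ennreal (norm (f x - s i x)) \<le> ennreal (3 * norm (f x))" for i
      proof (rule AE_I2, rule ennreal_leI)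
        fix x
        show "norm (f x - s i x) \<le> 3 * norm (f x)"
          using lim.hyps(3)[of x i] norm_triangle_ineq4[of "f x" "s i x"] by auto
      qed
      have "integrable lborel (\<lambda>x. 3 * norm (f x))" using lim.hyps(4) by simp
      then show "(\<integral>\<^sup>+x. ennreal (3 * norm (f x)) \<partial>lborel) < \<infinity>"
        by (subst nn_integral_eq_integral) auto
      show "AE x in lborel. (\<lambda>i. ennreal (norm (f x - s i x))) \<longlonglongrightarrow> 0"
      proof (rule AE_I2)
        fix x
        have "(\<lambda>i. norm (f x - s i x)) \<longlonglongrightarrow> norm (f x - f x)"
          by (intro tendsto_intros lim.hyps) auto
        then show "(\<lambda>i. ennreal (norm (f x - s i x))) \<longlonglongrightarrow> 0"
          by (metis cancel_comm_monoid_add_class.diff_cancel ennreal_0 norm_zero tendsto_ennrealI)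
      qed
    qed auto
    then have "\<forall>\<^sub>F i in sequentially. (\<integral>\<^sup>+x. norm (f x - s i x) \<partial>lborel) < ennreal e"
      using \<open>e > 0\<close> by (intro order_tendstoD(2)[where y=0]) auto
    then obtain i where "(\<integral>\<^sup>+x. norm (f x - s i x) \<partial>lborel) < ennreal e"
      by (auto simp: eventually_sequentially)
    then show "\<exists>g\<in>borel_measurable borel. L1_translation_continuous g \<and>
        (\<integral>\<^sup>+x. norm (f x - g x) \<partial>lborel) \<le> ennreal e"
      using lim.IH by (intro bexI[of _ "s i"]) auto
  qed
qed

section \<open>Locally integrable functions\<close>

lemma cball_in_sets_borel [measurable]: "cball (a::'a::euclidean_space) r \<in> sets borel"
  by simp

text \<open>Integrability on the balls around the origin is the same as integrability on compact sets.\<close>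

definition loc_integrable :: "('a::euclidean_space \<Rightarrow> 'b::euclidean_space) \<Rightarrow> bool" where
  "loc_integrable f \<longleftrightarrow> f \<in> borel_measurable borel \<and>
     (\<forall>R. integrable lborel (\<lambda>x. indicator (cball 0 R) x *\<^sub>R f x))"

lemma loc_integrable_bound:
  assumes "loc_integrable f" "g \<in> borel_measurable borel" "\<And>x. norm (g x) \<le> norm (f x)"
  shows "loc_integrable g"
  unfolding loc_integrable_def
proof (intro conjI allI)
  fix R :: real
  have [measurable]: "g \<in> borel_measurable borel" by fact
  have "integrable lborel (\<lambda>x. indicator (cball 0 R) x *\<^sub>R f x)"
    using assms unfolding loc_integrable_def by auto
  then show "integrable lborel (\<lambda>x. indicator (cball 0 R) x *\<^sub>R g x)"
    by (rule Bochner_Integration.integrable_bound) (use assms(3) in \<open>auto simp: indicator_def\<close>)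
qed fact

lemma loc_integrable_add:
  assumes "loc_integrable f" "loc_integrable g"
  shows "loc_integrable (\<lambda>x. f x + g x)"
  using assms unfolding loc_integrable_def by (auto simp: scaleR_add_right)

lemma loc_integrable_continuous:
  fixes f :: "'a::euclidean_space \<Rightarrow> 'b::euclidean_space"
  assumes "continuous_on UNIV f"
  shows "loc_integrable f"
  unfolding loc_integrable_def
  using assms by (auto intro!: borel_integrable_compact borel_measurable_continuous_onI
      intro: continuous_on_subset)

lemma integrable_continuous_compact_support:
  fixes f :: "'a::euclidean_space \<Rightarrow> 'b::euclidean_space"
  assumes "continuous_on UNIV f" "\<And>x. norm x > R \<Longrightarrow> f x = 0"
  shows "integrable lborel f"
proof -
  have "integrable lborel (\<lambda>x. indicator (cball 0 R) x *\<^sub>R f x)"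
    using loc_integrable_continuous[OF assms(1)] by (simp add: loc_integrable_def)
  also have "(\<lambda>x. indicator (cball 0 R) x *\<^sub>R f x) = f"
    using assms(2) by (force simp: indicator_def fun_eq_iff)
  finally show ?thesis .
qed

lemma integrable_compact_support_mult:
  fixes f :: "'a::euclidean_space \<Rightarrow> 'b::euclidean_space" and g :: "'a \<Rightarrow> 'c::euclidean_space"
    and h :: "'a \<Rightarrow> 'd::euclidean_space"
  assumes f: "loc_integrable f" and h[measurable]: "h \<in> borel_measurable borel"
    and le: "\<And>x. norm (h x) \<le> norm (f x) * norm (g x)"
    and g: "continuous_on UNIV g" "\<And>x. norm x > R \<Longrightarrow> g x = 0"
  shows "integrable lborel h"
proof -
  have "compact (g ` cball 0 R)"
    by (intro compact_continuous_image continuous_on_subset[OF g(1)]) auto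
  then obtain B where B: "\<And>x. norm x \<le> R \<Longrightarrow> norm (g x) \<le> B"
    using compact_imp_bounded[of "g ` cball 0 R"] unfolding bounded_iff by (metis (no_types) imageI mem_cball_0)
  have "integrable lborel (\<lambda>x. indicator (cball 0 R) x *\<^sub>R f x)"
    using f by (simp add: loc_integrable_def)
  then have "integrable lborel (\<lambda>x. \<bar>B\<bar> *\<^sub>R (indicator (cball 0 R) x *\<^sub>R f x))"
    by (rule integrable_scaleR_right)
  then show ?thesis
  proof (rule Bochner_Integration.integrable_bound)
    show "AE x in lborel. norm (h x) \<le> norm (\<bar>B\<bar> *\<^sub>R (indicator (cball 0 R) x *\<^sub>R f x))"
    proof (rule AE_I2)
      fix x :: 'a
      show "norm (h x) \<le> norm (\<bar>B\<bar> *\<^sub>R (indicator (cball 0 R) x *\<^sub>R f x))"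
      proof (cases "norm x \<le> R")
        case True
        have "norm (f x) * norm (g x) \<le> norm (f x) * \<bar>B\<bar>"
          using B[OF True] by (intro mult_left_mono) auto
        then show ?thesis using le[of x] True by (simp add: mult.commute)
      next
        case False
        then show ?thesis using le[of x] g(2)[of x] by simp
      qed
    qed
  qed simp
qed

text \<open>Truncation at height \<open>M\<close>: below it the weight \<open>a powr (r - 1)\<close> is bounded, and above it the
  product is controlled by the \<open>r\<close>-th powers of the large values alone. With \<open>a\<close>, \<open>b\<close>, \<open>d\<close> the sizes of
  \<open>G x\<close>, \<open>G (x + y)\<close> and their difference, this replaces the use of Hoelder's inequality.\<close>

lemma powr_times_distance_le:
  fixes a b d M r :: real
  assumes "0 \<le> a" "0 \<le> b" "0 \<le> d" "d \<le> a + b" "r \<ge> 1" "M \<ge> 0"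
  shows "a powr (r - 1) * d \<le> M powr (r - 1) * d + 2 * (if a > M then a powr r else 0)
      + (if b > M then b powr r else 0)"
proof (cases "a \<le> M")
  case True
  then have "a powr (r - 1) * d \<le> M powr (r - 1) * d"
    using assms by (intro mult_right_mono powr_mono2) auto
  then show ?thesis using True by (simp add: add_increasing2)
next
  case False
  have split: "x powr r = x powr (r - 1) * x" if "x \<ge> 0" for x :: real
    using powr_mult_base[OF that, of "r - 1"] by (simp add: mult.commute)
  have "a powr (r - 1) * d \<le> a powr (r - 1) * (a + b)"
    using assms by (intro mult_left_mono) auto
  also have "\<dots> = a powr r + a powr (r - 1) * b"
    using split[of a] assms by (simp add: algebra_simps)
  also have "a powr (r - 1) * b \<le> a powr r + (if b > M then b powr r else 0)"
  proof (cases "b \<le> a")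
    case True
    then have "a powr (r - 1) * b \<le> a powr (r - 1) * a"
      by (intro mult_left_mono) auto
    then have "a powr (r - 1) * b \<le> a powr r" using split[of a] assms by simp
    then show ?thesis by (simp add: add_increasing2)
  next
    case F: False
    then have "a powr (r - 1) * b \<le> b powr (r - 1) * b"
      using assms by (intro mult_right_mono powr_mono2) auto
    then have "a powr (r - 1) * b \<le> b powr r" using split[of b] assms by linarith
    then show ?thesis using F False by (simp add: add_increasing)
  qed
  finally have "a powr (r - 1) * d \<le> 2 * a powr r + (if b > M then b powr r else 0)" by simp
  moreover have "0 \<le> M powr (r - 1) * d" using assms by simp
  ultimately show ?thesis using False by simp
qed

text \<open>Choose the truncation height so that the tails of \<open>\<bar>G\<bar>\<^sup>r\<close> are small on a slightly larger ball;
  what remains is a constant times the \<open>L\<^sup>1\<close> modulus of continuity of \<open>G\<close>. This is the form in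
  which strong convergence of mollified gradients is needed: tested against \<open>\<bar>G\<bar> powr (r - 1)\<close>.\<close>

lemma powr_weighted_translation_continuous:
  fixes G :: "'a::euclidean_space \<Rightarrow> 'b::euclidean_space"
  assumes G[measurable]: "G \<in> borel_measurable borel"
    and Gr: "loc_integrable (\<lambda>x. norm (G x) powr r)" and r: "r \<ge> 1" and e: "e > 0"
  shows "\<exists>d>0. \<forall>y. norm y < d \<longrightarrow>
    (\<integral>\<^sup>+x. ennreal (indicator (cball 0 R) x * (norm (G x) powr (r - 1) * norm (G (x + y) - G x))) \<partial>lborel)
       \<le> ennreal e"
proof -
  let ?B = "cball 0 (R + 1) :: 'a set"
  \<comment> \<open>\<open>T M\<close> is the tail of the \<open>r\<close>-th power; shifts shorter than \<open>1\<close> move \<open>cball 0 R\<close> into \<open>?B\<close>.\<close>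
  define T where "T M z = (if norm z > M then norm z powr r else 0)" for M :: real and z :: 'b
  have [measurable]: "T M \<in> borel_measurable borel" for M unfolding T_def by measurable
  have T0: "0 \<le> T M z" for M z by (simp add: T_def)
  have intB: "integrable lborel (\<lambda>x. indicator ?B x * norm (G x) powr r)"
    using Gr by (simp add: loc_integrable_def)
  have "(\<lambda>M::nat. \<integral>\<^sup>+x. ennreal (indicator ?B x * T M (G x)) \<partial>lborel) \<longlonglongrightarrow> (\<integral>\<^sup>+x. 0 \<partial>(lborel::'a measure))"
  proof (rule nn_integral_dominated_convergence[where w="\<lambda>x. ennreal (indicator ?B x * norm (G x) powr r)"])
    show "(\<integral>\<^sup>+x. ennreal (indicator ?B x * norm (G x) powr r) \<partial>lborel) < \<infinity>"
      using intB by (subst nn_integral_eq_integral) auto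
    show "AE x in lborel. (\<lambda>M::nat. ennreal (indicator ?B x * T M (G x))) \<longlonglongrightarrow> 0"
    proof (rule AE_I2)
      fix x :: 'a
      have "\<forall>\<^sub>F M::nat in sequentially. real M \<ge> norm (G x)"
        using eventually_ge_at_top[of "nat \<lceil>norm (G x)\<rceil>"] by eventually_elim linarith
      then have "\<forall>\<^sub>F M::nat in sequentially. ennreal (indicator ?B x * T M (G x)) = 0"
        by eventually_elim (simp add: T_def)
      then show "(\<lambda>M::nat. ennreal (indicator ?B x * T M (G x))) \<longlonglongrightarrow> 0"
        by (rule tendsto_eventually)
    qed
    show "AE x in lborel. ennreal (indicator ?B x * T M (G x)) \<le> ennreal (indicator ?B x * norm (G x) powr r)" for M
      by (intro AE_I2 ennreal_leI mult_left_mono) (auto simp: T_def)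
  qed measurable
  then have "\<forall>\<^sub>F M::nat in sequentially. (\<integral>\<^sup>+x. ennreal (indicator ?B x * T M (G x)) \<partial>lborel) < ennreal (e/6)"
    using e by (intro order_tendstoD(2)[where y=0]) auto
  then obtain M :: nat where M: "(\<integral>\<^sup>+x. ennreal (indicator ?B x * T M (G x)) \<partial>lborel) < ennreal (e/6)"
    by (auto simp: eventually_sequentially)
  define F where "F x = indicator ?B x *\<^sub>R G x" for x
  have [measurable]: "F \<in> borel_measurable borel" unfolding F_def by measurable
  have "loc_integrable (\<lambda>x. 1 + norm (G x) powr r)"
    by (intro loc_integrable_add loc_integrable_continuous Gr) auto
  then have "loc_integrable G"
  proof (rule loc_integrable_bound)
    fix x
    show "norm (G x) \<le> norm (1 + norm (G x) powr r)"
    proof (cases "norm (G x) \<le> 1")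
      case False
      then have "norm (G x) powr 1 \<le> norm (G x) powr r" using r by (intro powr_mono) auto
      then show ?thesis using False by simp
    qed (simp add: add_increasing2)
  qed simp
  then have "integrable lborel F" by (simp add: loc_integrable_def F_def[abs_def])
  then have "L1_translation_continuous F" by (rule L1_translation_continuous)
  moreover define e' where "e' = e / 2 / (real M powr (r - 1) + 1)"
  moreover have "e' > 0" using e by (simp add: e'_def add_nonneg_pos)
  ultimately obtain d where d: "d > 0"
      "\<And>y. norm y < d \<Longrightarrow> (\<integral>\<^sup>+x. norm (F (x + y) - F x) \<partial>lborel) \<le> ennreal e'"
    unfolding L1_translation_continuous_def by meson
  have "(\<integral>\<^sup>+x. ennreal (indicator (cball 0 R) x * (norm (G x) powr (r - 1) * norm (G (x + y) - G x))) \<partial>lborel)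
       \<le> ennreal e" if y: "norm y < min d 1" for y
  proof -
    let ?M = "real M powr (r - 1)"
    have "(\<integral>\<^sup>+x. ennreal (indicator (cball 0 R) x * (norm (G x) powr (r - 1) * norm (G (x + y) - G x))) \<partial>lborel)
      \<le> (\<integral>\<^sup>+x. ennreal ?M * ennreal (norm (F (x + y) - F x)) + 2 * ennreal (indicator ?B x * T M (G x))
            + ennreal (indicator ?B (x + y) * T M (G (x + y))) \<partial>lborel)"
    proof (intro nn_integral_mono)
      fix x
      show "ennreal (indicator (cball 0 R) x * (norm (G x) powr (r - 1) * norm (G (x + y) - G x)))
        \<le> ennreal ?M * ennreal (norm (F (x + y) - F x)) + 2 * ennreal (indicator ?B x * T M (G x))
            + ennreal (indicator ?B (x + y) * T M (G (x + y)))"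
      proof (cases "norm x \<le> R")
        case True
        then have xy: "x \<in> ?B" "x + y \<in> ?B" using norm_triangle_ineq[of x y] y by auto
        have "norm (G x) powr (r - 1) * norm (G (x + y) - G x) \<le>
            ?M * norm (G (x + y) - G x) + 2 * T M (G x) + T M (G (x + y))"
          unfolding T_def using r norm_triangle_ineq4[of "G (x + y)" "G x"]
          by (intro powr_times_distance_le) (auto simp: add.commute)
        then show ?thesis
          using True xy T0 
          by (simp add: F_def ennreal_leI flip: ennreal_plus ennreal_mult ennreal_numeral)
      qed auto
    qed
    also have "\<dots> = ennreal ?M * (\<integral>\<^sup>+x. norm (F (x + y) - F x) \<partial>lborel)
        + 2 * (\<integral>\<^sup>+x. indicator ?B x * T M (G x) \<partial>lborel)
        + (\<integral>\<^sup>+x. indicator ?B (x + y) * T M (G (x + y)) \<partial>lborel)"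
      by (simp add: nn_integral_add nn_integral_cmult)
    also have "(\<integral>\<^sup>+x. indicator ?B (x + y) * T M (G (x + y)) \<partial>lborel)
        = (\<integral>\<^sup>+x. indicator ?B x * T M (G x) \<partial>lborel)"
      using nn_integral_lborel_affine_isometry[of "\<lambda>x. ennreal (indicator ?B x * T M (G x))" 1 y]
      by (simp add: add.commute)
    also have "ennreal ?M * (\<integral>\<^sup>+x. norm (F (x + y) - F x) \<partial>lborel)
        + 2 * (\<integral>\<^sup>+x. indicator ?B x * T M (G x) \<partial>lborel)
        + (\<integral>\<^sup>+x. indicator ?B x * T M (G x) \<partial>lborel)
      \<le> ennreal ?M * ennreal e' + 2 * ennreal (e/6) + ennreal (e/6)"
      using y M by (intro add_mono mult_left_mono d(2)) auto
    also have "\<dots> = ennreal (?M * e' + 2 * (e/6) + e/6)"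
      using \<open>e' > 0\<close> e by (simp flip: ennreal_plus ennreal_mult ennreal_numeral)
    also have "?M * e' \<le> e / 2"
    proof -
      have "?M * e' \<le> (?M + 1) * e'" using \<open>e' > 0\<close> by (intro mult_right_mono) auto
      also have "?M + 1 \<noteq> 0" using powr_ge_zero[of "real M" "r - 1"] by linarith
      then have "(?M + 1) * e' = e / 2"
        unfolding e'_def using nonzero_mult_div_cancel_left[of "?M + 1" "e / 2"] times_divide_eq_right by metis
      finally show ?thesis .
    qed
    then have "ennreal (?M * e' + 2 * (e/6) + e/6) \<le> ennreal e"
      by (intro ennreal_leI) auto
    finally show ?thesis .
  qed
  then show ?thesis using d(1) by (intro exI[of _ "min d 1"]) auto
qed

section \<open>Test functions and mollification\<close>

lemma GDERIV_imp_grad: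
  assumes "GDERIV f x :> D" shows "grad f x = D" "f differentiable (at x)"
proof -
  show d: "f differentiable (at x)"
    using assms unfolding gderiv_def differentiable_def by blast
  have "(f has_derivative (\<lambda>h. h \<bullet> grad f x)) (at x)"
    using GDERIV_grad[OF d] by (simp add: gderiv_def)
  then have "(\<lambda>h. h \<bullet> grad f x) = (\<lambda>h. h \<bullet> D)"
    using assms has_derivative_unique unfolding gderiv_def by blast
  then have "h \<bullet> grad f x = h \<bullet> D" for h by (rule fun_cong)
  then show "grad f x = D" using vector_eq_ldot by blast
qed

lemma GDERIV_imp_continuous_on:
  assumes "\<And>x. GDERIV f x :> g x" shows "continuous_on UNIV f"
  using assms unfolding gderiv_def
  by (metis continuous_at_imp_continuous_on has_derivative_continuous)

lemma C1cI:
  assumes "\<And>x. GDERIV f x :> g x" "continuous_on UNIV g" "\<And>x. norm x > R \<Longrightarrow> f x = 0"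
  shows "f \<in> C1c UNIV" "grad f = g"
proof -
  show g: "grad f = g" using GDERIV_imp_grad(1)[OF assms(1)] by (simp add: fun_eq_iff)
  have "{x. f x \<noteq> 0} \<subseteq> cball 0 R" using assms(3) by force
  then have "bounded (closure {x. f x \<noteq> 0})"
    by (intro bounded_closure bounded_subset[OF bounded_cball])
  then have "compact (closure {x. f x \<noteq> 0})" by (simp add: compact_eq_bounded_closed)
  then show "f \<in> C1c UNIV"
    using GDERIV_imp_grad(2)[OF assms(1)] g assms(2) by (simp add: C1c_def)
qed

lemma C1cD:
  assumes "f \<in> C1c UNIV"
  shows "GDERIV f x :> grad f x" "continuous_on UNIV (grad f)" "continuous_on UNIV f"
  using assms by (auto simp: C1c_def GDERIV_grad differentiable_imp_continuous_within
      intro!: continuous_at_imp_continuous_on)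

lemma C1c_bounded_support:
  assumes "f \<in> C1c UNIV"
  obtains R where "R > 0" "\<And>x. norm x > R \<Longrightarrow> f x = 0" "\<And>x. norm x > R \<Longrightarrow> grad f x = 0"
proof -
  obtain R where R: "\<And>x. x \<in> closure {x. f x \<noteq> 0} \<Longrightarrow> norm x \<le> R"
    using assms compact_imp_bounded[of "closure {x. f x \<noteq> 0}"] unfolding bounded_iff C1c_def by auto
  have 0: "f x = 0" if "norm x > R" for x
    using R[of x] that closure_subset[of "{x. f x \<noteq> 0}"] by force
  have "grad f x = 0" if "norm x > R" for x
  proof -
    have "open {x::'a. norm x > R}" by (intro open_Collect_less continuous_intros)
    then have "GDERIV f x :> 0"
      using has_derivative_transform_within_open[of "\<lambda>_. 0" "\<lambda>_. 0" x UNIV "{x. norm x > R}" f] that 0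
      by (simp add: gderiv_def)
    then show ?thesis by (rule GDERIV_imp_grad)
  qed
  with 0 show ?thesis by (intro that[of "max R 1"]) auto
qed

definition mollify :: "('a::euclidean_space \<Rightarrow> real) \<Rightarrow> ('a \<Rightarrow> 'b::euclidean_space) \<Rightarrow> 'a \<Rightarrow> 'b" where
  "mollify k f x = (\<integral>t. k (x - t) *\<^sub>R f t \<partial>lborel)"

lemma integral_eq_integral_cbox:
  fixes f :: "'a::euclidean_space \<Rightarrow> 'b::euclidean_space"
  assumes "continuous_on UNIV f" "\<And>x. x \<notin> cbox a b \<Longrightarrow> f x = 0"
  shows "(\<integral>x. f x \<partial>lborel) = integral (cbox a b) f"
proof -
  have "integrable lborel (\<lambda>x. indicator (cbox a b) x *\<^sub>R f x)"
    by (intro borel_integrable_compact continuous_on_subset[OF assms(1)]) auto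
  moreover have *: "(\<lambda>x. indicator (cbox a b) x *\<^sub>R f x) = f"
    using assms(2) by (auto simp: fun_eq_iff indicator_def)
  ultimately have "integral UNIV f = (\<integral>x. f x \<partial>lborel)" by (simp add: integral_lborel)
  moreover have "integral UNIV f = integral (cbox a b) f"
  proof -
    have "f = (\<lambda>x. if x \<in> cbox a b then f x else 0)" using assms(2) by auto
    then show ?thesis using integral_restrict_UNIV[of "cbox a b" f] by simp
  qed
  ultimately show ?thesis by simp
qed

text \<open>For \<open>x\<close> in the unit ball around \<open>x0\<close> the convolution is an integral over one fixed box, so that
  differentiation under the integral sign applies.\<close>

lemma mollify_C1:
  fixes u :: "'a::euclidean_space \<Rightarrow> real"
  assumes k: "k \<in> C1c UNIV" and u: "continuous_on UNIV u"
  defines "g \<equiv> \<lambda>x. \<integral>t. u t *\<^sub>R grad k (x - t) \<partial>lborel"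
  shows "GDERIV (mollify k u) x0 :> g x0" and "isCont g x0"
proof -
  note kD = C1cD[OF k]
  obtain R where R: "R > 0" "\<And>x. norm x > R \<Longrightarrow> k x = 0" "\<And>x. norm x > R \<Longrightarrow> grad k x = 0"
    using C1c_bounded_support[OF k] by blast
  obtain a b where ab: "cball x0 (R + 1) \<subseteq> cbox a b"
    using bounded_subset_cbox_symmetric[of "cball x0 (R + 1)"] by blast
  have far: "norm (x - t) > R" if "x \<in> ball x0 1" "t \<notin> cbox a b" for x t
  proof -
    have "t \<notin> cball x0 (R + 1)" using ab that by blast
    then have "norm (x0 - t) > R + 1" by (simp add: dist_norm)
    moreover have "norm (x0 - t) \<le> norm (x0 - x) + norm (x - t)" by norm
    ultimately show ?thesis using that by (simp add: dist_norm)
  qed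
  have contk: "continuous_on S (\<lambda>t. k (p t))" "continuous_on S (\<lambda>t. grad k (p t))"
    if "continuous_on S p" for S :: "'b::topological_space set" and p
    using continuous_on_compose2[OF kD(3) that] continuous_on_compose2[OF kD(2) that] by auto
  have contu: "continuous_on S (\<lambda>t. u (p t))" if "continuous_on S p"
    for S :: "'b::topological_space set" and p
    using continuous_on_compose2[OF u that] by auto
  define f where "f x t = k (x - t) *\<^sub>R u t" for x t
  define fx where "fx x t = blinfun_inner_left (u t *\<^sub>R grad k (x - t))" for x t
  have "((\<lambda>x. integral (cbox a b) (f x)) has_derivative integral (cbox a b) (fx x0)) (at x0 within UNIV)"
  proof (rule leibniz_rule)
    fix x t :: 'a
    have "((\<lambda>x. k (x - t)) has_derivative (\<lambda>h. h \<bullet> grad k (x - t))) (at x)"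
    proof -
      have "((\<lambda>x. x - t) has_derivative (\<lambda>h. h)) (at x)"
        by (auto intro!: derivative_eq_intros)
      from has_derivative_compose[OF this kD(1)[of "x - t", unfolded gderiv_def]] show ?thesis .
    qed
    then show "((\<lambda>x. f x t) has_derivative blinfun_apply (fx x t)) (at x within UNIV)"
      unfolding f_def fx_def by (auto intro!: derivative_eq_intros simp: mult.commute)
    show "f x integrable_on cbox a b" unfolding f_def
      by (intro integrable_continuous contk contu continuous_intros)
    show "continuous_on (UNIV \<times> cbox a b) (\<lambda>(x, t). fx x t)"
      unfolding fx_def split_beta
      by (intro bounded_linear.continuous_on[OF bounded_linear_blinfun_inner_left] contk contu continuous_intros)
  qed auto
  moreover have "blinfun_apply (integral (cbox a b) (fx x0)) = (\<lambda>h. h \<bullet> integral (cbox a b) (\<lambda>t. u t *\<^sub>R grad k (x0 - t)))"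
  proof -
    have "integral (cbox a b) (fx x0) = blinfun_inner_left (integral (cbox a b) (\<lambda>t. u t *\<^sub>R grad k (x0 - t)))"
      unfolding fx_def
      by (intro integral_linear[OF _ bounded_linear_blinfun_inner_left, unfolded o_def]
        integrable_continuous contk contu continuous_intros)
    then show ?thesis by auto
  qed
  ultimately have D: "GDERIV (\<lambda>x. integral (cbox a b) (f x)) x0 :> integral (cbox a b) (\<lambda>t. u t *\<^sub>R grad k (x0 - t))"
    by (simp add: gderiv_def)
  have eq: "mollify k u x = integral (cbox a b) (f x)" if "x \<in> ball x0 1" for x
    unfolding mollify_def f_def using far[OF that] R(2)
    by (intro integral_eq_integral_cbox contk contu continuous_intros) auto
  have eqg: "g x = integral (cbox a b) (\<lambda>t. u t *\<^sub>R grad k (x - t))" if "x \<in> ball x0 1" for x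
    unfolding g_def using far[OF that] R(3)
    by (intro integral_eq_integral_cbox contk contu continuous_intros) auto
  show "GDERIV (mollify k u) x0 :> g x0"
    using has_derivative_transform_within_open[OF D[unfolded gderiv_def], of "ball x0 1" "mollify k u"] eq eqg
    by (simp add: gderiv_def)
  have "continuous_on UNIV (\<lambda>x. integral (cbox a b) (\<lambda>t. u t *\<^sub>R grad k (x - t)))"
    unfolding split_beta
    by (intro integral_continuous_on_param[unfolded split_beta] contk contu continuous_intros)
  then have "isCont (\<lambda>x. integral (cbox a b) (\<lambda>t. u t *\<^sub>R grad k (x - t))) x0"
    by (simp add: continuous_on_eq_continuous_at)
  moreover have "\<forall>\<^sub>F x in nhds x0. integral (cbox a b) (\<lambda>t. u t *\<^sub>R grad k (x - t)) = g x"
    using eventually_nhds_in_open[of "ball x0 1" x0] by (auto elim!: eventually_mono simp: eqg)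
  ultimately show "isCont g x0" by (simp only: isCont_cong)
qed

text \<open>The coordinatewise identities of \<open>has_weak_gradient\<close> as one vector identity, for Borel fields and
  Lebesgue-Borel measure, where Tonelli's theorem is available.\<close>

definition weak_gradient :: "('a::euclidean_space \<Rightarrow> real) \<Rightarrow> ('a \<Rightarrow> 'a) \<Rightarrow> bool" where
  "weak_gradient u G \<longleftrightarrow> loc_integrable G \<and>
     (\<forall>\<phi>\<in>C1c UNIV. (\<integral>x. u x *\<^sub>R grad \<phi> x \<partial>lborel) = - (\<integral>x. \<phi> x *\<^sub>R G x \<partial>lborel))"

lemma C1c_reflect:
  assumes k: "k \<in> C1c UNIV"
  shows "(\<lambda>t. k (x - t)) \<in> C1c UNIV" "grad (\<lambda>t. k (x - t)) = (\<lambda>t. - grad k (x - t))"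
proof -
  note kD = C1cD[OF k]
  obtain R where R: "R > 0" "\<And>x. norm x > R \<Longrightarrow> k x = 0" "\<And>x. norm x > R \<Longrightarrow> grad k x = 0"
    using C1c_bounded_support[OF k] by blast
  have D: "GDERIV (\<lambda>t. k (x - t)) t :> - grad k (x - t)" for t
    proof -
    have "((\<lambda>t. x - t) has_derivative (\<lambda>h. - h)) (at t)"
      by (auto intro!: derivative_eq_intros)
    from has_derivative_compose[OF this kD(1)[of "x - t", unfolded gderiv_def]] show ?thesis
      by (simp add: gderiv_def)
  qed
  have c: "continuous_on UNIV (\<lambda>t. - grad k (x - t))"
    by (intro continuous_intros continuous_on_compose2[OF kD(2)]) auto
  have z: "k (x - t) = 0" if "norm t > R + norm x" for t
    using R(2)[of "x - t"] norm_triangle_ineq2[of t x] that by (simp add: norm_minus_commute)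
  from C1cI[OF D c z] show "(\<lambda>t. k (x - t)) \<in> C1c UNIV" "grad (\<lambda>t. k (x - t)) = (\<lambda>t. - grad k (x - t))"
    by blast+
qed

text \<open>Use \<open>t \<mapsto> k (x - t)\<close> as a test function: the gradient of the mollification is the mollification of
  the weak gradient.\<close>

lemma mollify_weak_gradient:
  fixes u :: "'a::euclidean_space \<Rightarrow> real"
  assumes k: "k \<in> C1c UNIV" and u: "continuous_on UNIV u" and G: "weak_gradient u G"
  shows "GDERIV (mollify k u) x :> mollify k G x" and "continuous_on UNIV (mollify k G)"
proof -
  have eq: "(\<integral>t. u t *\<^sub>R grad k (y - t) \<partial>lborel) = mollify k G y" for y
  proof -
    have "(\<integral>t. u t *\<^sub>R grad (\<lambda>t. k (y - t)) t \<partial>lborel) = - mollify k G y"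
      using G C1c_reflect(1)[OF k, of y] unfolding weak_gradient_def mollify_def by blast
    then have "(\<integral>t. - (u t *\<^sub>R grad k (y - t)) \<partial>lborel) = - mollify k G y"
      by (simp add: C1c_reflect(2)[OF k])
    then show ?thesis by simp
  qed
  show "GDERIV (mollify k u) x :> mollify k G x"
    using mollify_C1(1)[OF k u, of x] eq by simp
  show "continuous_on UNIV (mollify k G)"
    using mollify_C1(2)[OF k u] eq by (simp add: continuous_on_eq_continuous_at)
qed

text \<open>The positive part squared is the simplest \<open>C\<^sup>1\<close> function vanishing on a half line; composing it with
  quadratic polynomials gives all the bump and cutoff functions below.\<close>

definition pos_sq :: "real \<Rightarrow> real" where "pos_sq t = (max 0 t)\<^sup>2"

lemma pos_sq_has_derivative: "(pos_sq has_field_derivative 2 * max 0 t) (at t)"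
proof -
  consider "t > 0" | "t < 0" | "t = 0" by linarith
  then show ?thesis
  proof cases
    case 1
    have "((\<lambda>x. x\<^sup>2) has_field_derivative 2 * t) (at t)" by (auto intro!: derivative_eq_intros)
    then have "(pos_sq has_field_derivative 2 * t) (at t)"
      by (rule has_field_derivative_transform_within_open[of _ _ _ "{0<..}"]) (use 1 in \<open>auto simp: pos_sq_def\<close>)
    then show ?thesis using 1 by simp
  next
    case 2
    have "(pos_sq has_field_derivative 0) (at t)"
      by (rule has_field_derivative_transform_within_open[of "\<lambda>_. 0" _ _ "{..<0}"]) (use 2 in \<open>auto simp: pos_sq_def\<close>)
    then show ?thesis using 2 by simp
  next
    case 3
    have "(\<lambda>h. (pos_sq (0 + h) - pos_sq 0) / h) \<midarrow>0\<rightarrow> 0"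
    proof (rule Lim_null_comparison)
      show "\<forall>\<^sub>F h in at 0. norm ((pos_sq (0 + h) - pos_sq 0) / h) \<le> \<bar>h\<bar>"
        by (rule always_eventually) (auto simp: pos_sq_def max_def power2_eq_square)
      show "(\<lambda>h::real. \<bar>h\<bar>) \<midarrow>0\<rightarrow> 0" by (rule tendsto_rabs_zero) (rule tendsto_ident_at)
    qed
    then show ?thesis using 3 by (simp add: DERIV_def)
  qed
qed

lemma pos_sq_nonneg: "0 \<le> pos_sq t" by (simp add: pos_sq_def)

lemma pos_sq_eq_0: "t \<le> 0 \<Longrightarrow> pos_sq t = 0" by (simp add: pos_sq_def)

lemma GDERIV_radial:
  fixes x :: "'a::euclidean_space"
  assumes "DERIV h (x \<bullet> x) :> D"
  shows "GDERIV (\<lambda>x. h (x \<bullet> x)) x :> (2 * D) *\<^sub>R x"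
proof -
  have "GDERIV (\<lambda>x. x \<bullet> x) x :> 2 *\<^sub>R x"
    unfolding gderiv_def by (auto intro!: derivative_eq_intros simp: inner_commute)
  from GDERIV_DERIV_compose[OF this assms] show ?thesis by (simp add: mult.commute)
qed

text \<open>Symmetry lets \<open>mollify k f x\<close> be read as a mean of the values \<open>f (x + y)\<close>.\<close>

definition mollifier :: "real \<Rightarrow> ('a::euclidean_space \<Rightarrow> real) \<Rightarrow> bool" where
  "mollifier d k \<longleftrightarrow> k \<in> C1c UNIV \<and> (\<forall>x. 0 \<le> k x) \<and> (\<forall>x. k (- x) = k x) \<and>
     (\<forall>x. norm x \<ge> d \<longrightarrow> k x = 0) \<and> (\<integral>x. k x \<partial>lborel) = 1"

lemma C1c_scale:
  assumes "f \<in> C1c UNIV"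
  shows "(\<lambda>x. c * f x) \<in> C1c UNIV"
proof -
  obtain R where R: "R > 0" "\<And>x. norm x > R \<Longrightarrow> f x = 0" "\<And>x. norm x > R \<Longrightarrow> grad f x = 0"
    using C1c_bounded_support[OF assms] by blast
  have D: "GDERIV (\<lambda>x. c * f x) x :> c *\<^sub>R grad f x" for x
    using GDERIV_mult[OF GDERIV_const C1cD(1)[OF assms], of c x] by simp
  have c: "continuous_on UNIV (\<lambda>x. c *\<^sub>R grad f x)"
    by (intro continuous_intros C1cD(2) assms)
  have z: "\<And>x. norm x > R \<Longrightarrow> c * f x = 0" using R by simp
  show ?thesis by (rule C1cI(1)[OF D c z])
qed

lemma mollifier_exists:
  assumes "d > 0"
  shows "\<exists>k::'a::euclidean_space \<Rightarrow> real. mollifier d k"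
proof -
  define k0 :: "'a \<Rightarrow> real" where "k0 x = pos_sq (1 - (x \<bullet> x) / d\<^sup>2)" for x
  have D: "GDERIV k0 x :> (2 * (2 * max 0 (1 - (x \<bullet> x) / d\<^sup>2) * (- (1 / d\<^sup>2)))) *\<^sub>R x" for x
    unfolding k0_def
  proof (rule GDERIV_radial[of "\<lambda>s. pos_sq (1 - s / d\<^sup>2)"])
    have "((\<lambda>s. 1 - s / d\<^sup>2) has_field_derivative - (1 / d\<^sup>2)) (at (x \<bullet> x))"
      using DERIV_diff[OF DERIV_const[of 1] DERIV_cdivide[OF DERIV_ident]] by simp
    from DERIV_chain2[OF pos_sq_has_derivative this]
    show "((\<lambda>s. pos_sq (1 - s / d\<^sup>2)) has_field_derivative
        2 * max 0 (1 - x \<bullet> x / d\<^sup>2) * (- (1 / d\<^sup>2))) (at (x \<bullet> x))" .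
  qed
  have zero: "k0 x = 0" if "norm x \<ge> d" for x
  proof -
    have "d\<^sup>2 \<le> (norm x)\<^sup>2" using that assms by (intro power_mono) auto
    then have "1 \<le> (x \<bullet> x) / d\<^sup>2" using assms by (simp add: power2_norm_eq_inner)
    then show ?thesis by (simp add: k0_def pos_sq_eq_0)
  qed
  have k0: "k0 \<in> C1c UNIV"
    by (rule C1cI(1)[OF D, of d]) (use assms in \<open>auto intro!: continuous_intros zero\<close>)
  have cont: "continuous_on UNIV k0" using C1cD(3)[OF k0] .
  have int: "integrable lborel k0"
    using cont by (rule integrable_continuous_compact_support[of _ d]) (simp add: zero)
  define I where "I = (\<integral>x. k0 x \<partial>lborel)"
  have nn: "0 \<le> k0 x" for x by (simp add: k0_def pos_sq_nonneg)
  have "I \<noteq> 0"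
  proof
    assume "I = 0"
    then have "AE x in lborel. k0 x = 0"
      using integral_nonneg_eq_0_iff_AE[OF int] nn by (simp add: I_def)
    then have "AE x in lebesgue. x \<notin> {x. k0 x \<noteq> 0}" by (auto dest: AE_completion)
    moreover have op: "open {x. k0 x \<noteq> 0}"
      using cont by (intro open_Collect_neq continuous_intros)
    ultimately have "negligible {x. k0 x \<noteq> 0}"
      by (simp add: negligible_iff_null_sets AE_iff_null_sets)
    moreover have "k0 0 \<noteq> 0" by (simp add: k0_def pos_sq_def)
    ultimately show False using open_not_negligible[OF op] by blast
  qed
  moreover have "I \<ge> 0" unfolding I_def using nn by simp
  ultimately have "I > 0" by simp
  then have "(\<integral>x. (1 / I) * k0 x \<partial>lborel) = 1" by (simp add: I_def)
  moreover have "k0 (- x) = k0 x" for x by (simp add: k0_def)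
  ultimately have "mollifier d (\<lambda>x. (1 / I) * k0 x)"
    unfolding mollifier_def using C1c_scale[OF k0, of "1 / I"] zero nn \<open>I > 0\<close> by simp
  then show ?thesis by blast
qed

lemma mollifier_sequence:
  obtains d and k :: "nat \<Rightarrow> 'a::euclidean_space \<Rightarrow> real"
  where "d \<longlonglongrightarrow> 0" "\<And>j. mollifier (d j) (k j)"
proof -
  define d where "d j = inverse (real (Suc j))" for j
  have d: "d j > 0" "d \<longlonglongrightarrow> 0" for j
    using LIMSEQ_inverse_real_of_nat by (auto simp: d_def[abs_def])
  have "\<forall>j. \<exists>k::'a \<Rightarrow> real. mollifier (d j) k" using mollifier_exists d(1) by blast
  then obtain k :: "nat \<Rightarrow> 'a \<Rightarrow> real" where k: "\<And>j. mollifier (d j) (k j)" by metis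
  show ?thesis using d(2) k by (rule that)
qed

lemma mollifierD:
  assumes "mollifier d k"
  shows "k \<in> C1c UNIV" "0 \<le> k x" "k (- x) = k x" "norm x \<ge> d \<Longrightarrow> k x = 0" "(\<integral>x. k x \<partial>lborel) = 1"
    "integrable lborel k" "k \<in> borel_measurable borel" "(\<integral>\<^sup>+x. ennreal (k x) \<partial>lborel) = 1"
proof -
  show k: "k \<in> C1c UNIV" "0 \<le> k x" "k (- x) = k x" "norm x \<ge> d \<Longrightarrow> k x = 0"
    and 1: "(\<integral>x. k x \<partial>lborel) = 1" for x
    using assms by (auto simp: mollifier_def)
  show int: "integrable lborel k"
    using C1cD(3)[OF k(1)] by (rule integrable_continuous_compact_support[of _ d]) (simp add: k)
  then show "k \<in> borel_measurable borel" by (auto dest: borel_measurable_integrable)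
  show "(\<integral>\<^sup>+x. ennreal (k x) \<partial>lborel) = 1"
    using int k(2) 1 by (subst nn_integral_eq_integral) auto
qed

lemma mollify_translate:
  fixes f :: "'a::euclidean_space \<Rightarrow> 'b::euclidean_space"
  assumes k: "mollifier d k" and f: "loc_integrable f"
  shows "integrable lborel (\<lambda>y. k y *\<^sub>R f (x + y))"
    and "mollify k f x - f x = (\<integral>y. k y *\<^sub>R (f (x + y) - f x) \<partial>lborel)"
proof -
  note kD = mollifierD[OF k]
  have [measurable]: "f \<in> borel_measurable borel" "k \<in> borel_measurable borel"
    using f kD by (auto simp: loc_integrable_def)
  define F where "F t = k (x - t) *\<^sub>R f t" for t
  have [measurable]: "F \<in> borel_measurable borel" unfolding F_def by measurable
  have "(\<lambda>t. k (x - t)) \<in> C1c UNIV" by (rule C1c_reflect(1)[OF kD(1)])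
  then obtain R where "continuous_on UNIV (\<lambda>t. k (x - t))" "\<And>t. norm t > R \<Longrightarrow> k (x - t) = 0"
    using C1c_bounded_support C1cD(3) by metis
  then have intF: "integrable lborel F"
    by (intro integrable_compact_support_mult[OF f, of F "\<lambda>t. k (x - t)" R]) (auto simp: F_def mult.commute)
  have FF: "F (x + 1 *\<^sub>R y) = k y *\<^sub>R f (x + y)" for y
    using kD(3)[of y] by (simp add: F_def)
  have "integrable lborel (\<lambda>y. F (x + 1 *\<^sub>R y))"
    by (subst integral_lborel_affine_isometry(2)) (auto simp: intF)
  then show int: "integrable lborel (\<lambda>y. k y *\<^sub>R f (x + y))" by (simp only: FF)
  have "mollify k f x = (\<integral>t. F t \<partial>lborel)" by (simp add: mollify_def F_def)
  also have "\<dots> = (\<integral>y. F (x + 1 *\<^sub>R y) \<partial>lborel)"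
    by (subst integral_lborel_affine_isometry(1)) auto
  also have "\<dots> = (\<integral>y. k y *\<^sub>R f (x + y) \<partial>lborel)" by (simp only: FF)
  finally have "mollify k f x - f x = (\<integral>y. k y *\<^sub>R f (x + y) \<partial>lborel) - (\<integral>y. k y *\<^sub>R f x \<partial>lborel)"
    using kD(5,6) by simp
  also have "\<dots> = (\<integral>y. k y *\<^sub>R f (x + y) - k y *\<^sub>R f x \<partial>lborel)"
    by (rule Bochner_Integration.integral_diff[symmetric]) (use int kD(6) in auto)
  finally show "mollify k f x - f x = (\<integral>y. k y *\<^sub>R (f (x + y) - f x) \<partial>lborel)"
    by (simp add: scaleR_diff_right)
qed

lemma norm_mollify_diff_le:
  fixes f :: "'a::euclidean_space \<Rightarrow> 'b::euclidean_space"
  assumes k: "mollifier d k" and f: "loc_integrable f"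
  shows "ennreal (norm (mollify k f x - f x)) \<le> (\<integral>\<^sup>+y. ennreal (k y) * ennreal (norm (f (x + y) - f x)) \<partial>lborel)"
proof -
  note kD = mollifierD[OF k]
  have "integrable lborel (\<lambda>y. k y *\<^sub>R f (x + y) - k y *\<^sub>R f x)"
    using mollify_translate(1)[OF k f] kD(6) by auto
  then have "integrable lborel (\<lambda>y. k y *\<^sub>R (f (x + y) - f x))" by (simp add: scaleR_diff_right)
  from integral_norm_bound_ennreal[OF this]
  show ?thesis using kD(2) by (simp add: mollify_translate(2)[OF k f] ennreal_mult)
qed

text \<open>By Tonelli, a mean over \<open>y\<close> of the translation errors bounds the mollification error.\<close>

lemma mollify_weighted_error:
  fixes f :: "'a::euclidean_space \<Rightarrow> 'b::euclidean_space" and g :: "'a \<Rightarrow> real"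
  assumes k: "mollifier d k" and f: "loc_integrable f"
    and g[measurable]: "g \<in> borel_measurable borel" "\<And>x. 0 \<le> g x"
    and le: "\<And>y. norm y < d \<Longrightarrow> (\<integral>\<^sup>+x. ennreal (g x * norm (f (x + y) - f x)) \<partial>lborel) \<le> ennreal e"
  shows "(\<integral>\<^sup>+x. ennreal (g x * norm (mollify k f x - f x)) \<partial>lborel) \<le> ennreal e"
proof -
  note kD = mollifierD[OF k]
  have [measurable]: "f \<in> borel_measurable borel" "k \<in> borel_measurable borel"
    using f kD by (auto simp: loc_integrable_def)
  have "(\<integral>\<^sup>+x. ennreal (g x * norm (mollify k f x - f x)) \<partial>lborel)
    \<le> (\<integral>\<^sup>+x. (\<integral>\<^sup>+y. ennreal (k y) * ennreal (g x * norm (f (x + y) - f x)) \<partial>lborel) \<partial>lborel)"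
  proof (intro nn_integral_mono)
    fix x
    have "ennreal (g x * norm (mollify k f x - f x)) \<le>
        ennreal (g x) * (\<integral>\<^sup>+y. ennreal (k y) * ennreal (norm (f (x + y) - f x)) \<partial>lborel)"
      unfolding ennreal_mult'[OF g(2)] by (intro mult_left_mono norm_mollify_diff_le[OF k f]) auto
    also have "\<dots> = (\<integral>\<^sup>+y. ennreal (k y) * ennreal (g x * norm (f (x + y) - f x)) \<partial>lborel)"
      using g(2) by (subst nn_integral_cmult[symmetric]) (auto simp: ennreal_mult mult_ac)
    finally show "ennreal (g x * norm (mollify k f x - f x)) \<le>
        (\<integral>\<^sup>+y. ennreal (k y) * ennreal (g x * norm (f (x + y) - f x)) \<partial>lborel)" .
  qed
  also have "\<dots> = (\<integral>\<^sup>+y. (\<integral>\<^sup>+x. ennreal (k y) * ennreal (g x * norm (f (x + y) - f x)) \<partial>lborel) \<partial>lborel)"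
    by (rule lborel_pair.Fubini') measurable
  also have "\<dots> \<le> (\<integral>\<^sup>+y. ennreal (k y) * ennreal e \<partial>lborel)"
  proof (intro nn_integral_mono)
    fix y
    show "(\<integral>\<^sup>+x. ennreal (k y) * ennreal (g x * norm (f (x + y) - f x)) \<partial>lborel) \<le> ennreal (k y) * ennreal e"
    proof (cases "norm y < d")
      case True
      then show ?thesis using le[OF True] by (subst nn_integral_cmult) (auto intro: mult_left_mono)
    qed (simp add: kD(4))
  qed
  also have "\<dots> = ennreal e" by (subst nn_integral_multc) (auto simp: kD(8))
  finally show ?thesis .
qed

lemma mollify_nonneg:
  fixes u :: "'a::euclidean_space \<Rightarrow> real"
  assumes "mollifier d k" "\<And>x. 0 \<le> u x"
  shows "0 \<le> mollify k u x"
  unfolding mollify_def using mollifierD(2)[OF assms(1)] assms(2) by (intro Bochner_Integration.integral_nonneg) auto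

lemma mollify_pointwise_error:
  fixes f :: "'a::euclidean_space \<Rightarrow> 'b::euclidean_space"
  assumes k: "mollifier d k" and f: "loc_integrable f" and e: "0 \<le> e"
    and le: "\<And>y. norm y < d \<Longrightarrow> norm (f (x + y) - f x) \<le> e"
  shows "norm (mollify k f x - f x) \<le> e"
proof -
  note kD = mollifierD[OF k]
  have [measurable]: "k \<in> borel_measurable borel" using kD by simp
  have "ennreal (norm (mollify k f x - f x)) \<le> (\<integral>\<^sup>+y. ennreal (k y) * ennreal (norm (f (x + y) - f x)) \<partial>lborel)"
    by (rule norm_mollify_diff_le[OF k f])
  also have "\<dots> \<le> (\<integral>\<^sup>+y. ennreal (k y) * ennreal e \<partial>lborel)"
  proof (intro nn_integral_mono)
    fix y
    show "ennreal (k y) * ennreal (norm (f (x + y) - f x)) \<le> ennreal (k y) * ennreal e"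
      using le[of y] kD(4)[of y] by (cases "norm y < d") (auto intro!: mult_left_mono ennreal_leI)
  qed
  also have "\<dots> = ennreal e" by (subst nn_integral_multc) (auto simp: kD(8))
  finally show ?thesis using e by simp
qed

lemma mollify_tendsto:
  fixes f :: "'a::euclidean_space \<Rightarrow> 'b::euclidean_space"
  assumes k: "\<And>j. mollifier (d j) (k j)" and f: "continuous_on UNIV f" and d: "d \<longlonglongrightarrow> 0"
  shows "(\<lambda>j. mollify (k j) f x) \<longlonglongrightarrow> f x"
proof (rule tendstoI)
  fix e :: real assume "e > 0"
  have "isCont f x" using f by (simp add: continuous_on_eq_continuous_at)
  then obtain s where s: "s > 0" "\<And>y. norm (y - x) < s \<Longrightarrow> norm (f y - f x) < e/2"
    using \<open>e > 0\<close> unfolding continuous_at_eps_delta dist_norm by (meson half_gt_zero)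
  have "\<forall>\<^sub>F j in sequentially. d j < s" using d s(1) by (rule order_tendstoD)
  then show "\<forall>\<^sub>F j in sequentially. dist (mollify (k j) f x) (f x) < e"
  proof eventually_elim
    case (elim j)
    have "norm (mollify (k j) f x - f x) \<le> e/2"
      using s(2)[of "x + y" for y] elim \<open>e > 0\<close>
      by (intro mollify_pointwise_error[OF k] loc_integrable_continuous f less_imp_le) auto
    then show ?case using \<open>e > 0\<close> by (simp add: dist_norm)
  qed
qed

section \<open>Testing with powers of a cutoff divided by the solution\<close>

lemma continuous_on_inverse_add_one:
  fixes f :: "'a::topological_space \<Rightarrow> real"
  assumes "continuous_on UNIV f" "\<And>x. 0 \<le> f x"
  shows "continuous_on UNIV (\<lambda>x. inverse (f x + 1))"
proof (intro continuous_intros assms(1) ballI)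
  fix x show "f x + 1 \<noteq> 0" using assms(2)[of x] by simp
qed

lemma C1c_test_quotient:
  fixes U :: "'a::euclidean_space \<Rightarrow> real"
  assumes \<psi>: "\<psi> \<in> C1c UNIV" and U: "\<And>x. GDERIV U x :> H x" "continuous_on UNIV H" "\<And>x. 0 \<le> U x"
  defines "V \<equiv> \<lambda>x. \<psi> x * inverse (U x + 1)"
  shows "(\<lambda>x. V x ^ Suc m) \<in> C1c UNIV"
    and "grad (\<lambda>x. V x ^ Suc m) = (\<lambda>x. real (Suc m) *\<^sub>R
      ((V x ^ m * inverse (U x + 1)) *\<^sub>R grad \<psi> x - (V x ^ Suc m * inverse (U x + 1)) *\<^sub>R H x))"
proof -
  obtain R where R: "R > 0" "\<And>x. norm x > R \<Longrightarrow> \<psi> x = 0" "\<And>x. norm x > R \<Longrightarrow> grad \<psi> x = 0"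
    using C1c_bounded_support[OF \<psi>] by blast
  have pos: "U x + 1 > 0" for x using U(3)[of x] by simp
  have ne: "U x + 1 \<noteq> 0" for x using pos[of x] by simp
  define W where "W x = real (Suc m) *\<^sub>R
      ((V x ^ m * inverse (U x + 1)) *\<^sub>R grad \<psi> x - (V x ^ Suc m * inverse (U x + 1)) *\<^sub>R H x)" for x
  have D: "GDERIV (\<lambda>x. V x ^ Suc m) x :> W x" for x
  proof -
    have "GDERIV (\<lambda>x. U x + 1) x :> H x" using GDERIV_add[OF U(1) GDERIV_const] by simp
    from GDERIV_mult[OF C1cD(1)[OF \<psi>] GDERIV_inverse[OF this ne]]
    have "GDERIV V x :> \<psi> x *\<^sub>R (- (inverse (U x + 1))\<^sup>2 *\<^sub>R H x) + inverse (U x + 1) *\<^sub>R grad \<psi> x"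
      unfolding V_def .
    from GDERIV_DERIV_compose[OF this DERIV_pow[of "Suc m"]]
    have "GDERIV (\<lambda>x. V x ^ Suc m) x :> (real (Suc m) * V x ^ m) *\<^sub>R
        (\<psi> x *\<^sub>R (- (inverse (U x + 1))\<^sup>2 *\<^sub>R H x) + inverse (U x + 1) *\<^sub>R grad \<psi> x)"
      by simp
    also have "(real (Suc m) * V x ^ m) *\<^sub>R
        (\<psi> x *\<^sub>R (- (inverse (U x + 1))\<^sup>2 *\<^sub>R H x) + inverse (U x + 1) *\<^sub>R grad \<psi> x) = W x"
      unfolding W_def V_def by (simp add: algebra_simps power2_eq_square del: of_nat_Suc)
    finally show ?thesis .
  qed
  have contU: "continuous_on UNIV U" using U(1) by (rule GDERIV_imp_continuous_on)
  have c: "continuous_on UNIV W"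
    unfolding W_def V_def
    by (intro continuous_intros contU U(2) C1cD[OF \<psi>]) (simp_all add: ne)
  have z: "V x ^ Suc m = 0" if "norm x > R" for x
    using R(2)[OF that] by (simp add: V_def)
  from C1cI[OF D c z]
  show "(\<lambda>x. V x ^ Suc m) \<in> C1c UNIV" and "grad (\<lambda>x. V x ^ Suc m) = (\<lambda>x. real (Suc m) *\<^sub>R
      ((V x ^ m * inverse (U x + 1)) *\<^sub>R grad \<psi> x - (V x ^ Suc m * inverse (U x + 1)) *\<^sub>R H x))"
    unfolding W_def by blast+
qed

text \<open>The function \<open>(\<psi> / (u + 1)) ^ Suc m\<close> is only weakly differentiable, hence is replaced by its
  mollified counterpart, which is \<open>C\<^sup>1\<close>. In the resulting inequality the mollified gradient
  occurs in the product with \<open>A\<close> only; replacing it by \<open>G\<close> costs an error \<open>E\<close> that is small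
  by translation continuity, and the rest converges by domination, because the factors built from
  \<open>u\<close> converge pointwise and are bounded. The integrand is the gradient of the test function tested
  with \<open>A\<close>, divided by \<open>Suc m\<close>.\<close>

lemma test_quotient_inequality:
  fixes u :: "'a::euclidean_space \<Rightarrow> real"
  assumes u: "continuous_on UNIV u" "\<And>x. 0 \<le> u x" and G: "weak_gradient u G"
    and A: "loc_integrable A" and AG: "loc_integrable (\<lambda>x. norm (A x) * norm (G x))"
    and trans: "\<And>R e. e > 0 \<Longrightarrow> \<exists>d>0. \<forall>y. norm y < d \<longrightarrow>
      (\<integral>\<^sup>+x. ennreal (indicator (cball 0 R) x * norm (A x) * norm (G (x + y) - G x)) \<partial>lborel) \<le> ennreal e"
    and test: "\<And>\<phi>. \<phi> \<in> C1c UNIV \<Longrightarrow> (\<And>x. 0 \<le> \<phi> x) \<Longrightarrow> 0 \<le> (\<integral>x. A x \<bullet> grad \<phi> x \<partial>lborel)"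
    and \<psi>: "\<psi> \<in> C1c UNIV" "\<And>x. 0 \<le> \<psi> x"
  defines "V \<equiv> \<lambda>x. \<psi> x * inverse (u x + 1)"
  shows "integrable lborel (\<lambda>x. V x ^ m * inverse (u x + 1) * (A x \<bullet> grad \<psi> x)
      - V x ^ Suc m * inverse (u x + 1) * (A x \<bullet> G x))" (is ?integrable)
    and "0 \<le> (\<integral>x. V x ^ m * inverse (u x + 1) * (A x \<bullet> grad \<psi> x)
      - V x ^ Suc m * inverse (u x + 1) * (A x \<bullet> G x) \<partial>lborel)" (is ?nonneg)
proof -
  obtain R where R: "R > 0" "\<And>x. norm x > R \<Longrightarrow> \<psi> x = 0" "\<And>x. norm x > R \<Longrightarrow> grad \<psi> x = 0"
    using C1c_bounded_support[OF \<psi>(1)] by blast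
  note \<psi>D = C1cD[OF \<psi>(1)]
  obtain d and k :: "nat \<Rightarrow> 'a \<Rightarrow> real" where d: "d \<longlonglongrightarrow> 0" and k: "\<And>j. mollifier (d j) (k j)"
    using mollifier_sequence by blast
  note kC = mollifierD(1)[OF k]
  define w where "w j x = inverse (mollify (k j) u x + 1)" for j x
  define w0 where "w0 x = inverse (u x + 1)" for x
  define H where "H j = mollify (k j) G" for j
  have moll0: "0 \<le> mollify (k j) u x" for j x using mollify_nonneg[OF k] u(2) by blast
  have w1: "0 \<le> w j x" "w j x \<le> 1" for j x
    using moll0[of j x] by (auto simp: w_def inverse_le_1_iff)
  have w01: "0 \<le> w0 x" "w0 x \<le> 1" for x
    using u(2)[of x] by (auto simp: w0_def inverse_le_1_iff)
  have lim_w: "(\<lambda>j. w j x) \<longlonglongrightarrow> w0 x" for x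
    unfolding w_def w0_def using u(2)[of x]
    by (intro tendsto_intros mollify_tendsto[OF k u(1) d]) auto
  have contw0: "continuous_on UNIV w0"
    unfolding w0_def by (rule continuous_on_inverse_add_one[OF u])
  have contw: "continuous_on UNIV (w j)" for j
    unfolding w_def
    by (intro continuous_on_inverse_add_one moll0 GDERIV_imp_continuous_on[OF mollify_weak_gradient(1)[OF kC u(1) G]])
  have contH: "continuous_on UNIV (H j)" for j
    unfolding H_def by (rule mollify_weak_gradient(2)[OF kC u(1) G])
  have Gloc: "loc_integrable G" using G by (simp add: weak_gradient_def)
  have [measurable]: "G \<in> borel_measurable borel" "A \<in> borel_measurable borel"
    "\<psi> \<in> borel_measurable borel" "grad \<psi> \<in> borel_measurable borel" "w0 \<in> borel_measurable borel"
    using Gloc A \<psi>D contw0 by (auto simp: loc_integrable_def intro: borel_measurable_continuous_onI)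
  have [measurable]: "w j \<in> borel_measurable borel" "H j \<in> borel_measurable borel" for j
    using contw contH by (auto intro: borel_measurable_continuous_onI)
  define Q where "Q w x = (\<psi> x * w x) ^ m * w x * (A x \<bullet> grad \<psi> x)
      - (\<psi> x * w x) ^ Suc m * w x * (A x \<bullet> G x)" for w x
  define E where "E j x = (\<psi> x * w j x) ^ Suc m * w j x * (A x \<bullet> (H j x - G x))" for j x
  define Dom where "Dom x = norm (A x) * norm ((\<psi> x) ^ m *\<^sub>R grad \<psi> x)
      + norm (A x) * norm (G x) * norm ((\<psi> x) ^ Suc m)" for x
  \<comment> \<open>All powers of \<open>w j x\<close> and \<open>w0 x\<close> are at most \<open>1\<close>, so one majorant serves all \<open>j\<close>.\<close>
  have intDom: "integrable lborel Dom"
    unfolding Dom_def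
  proof (rule Bochner_Integration.integrable_add)
    show "integrable lborel (\<lambda>x. norm (A x) * norm ((\<psi> x) ^ m *\<^sub>R grad \<psi> x))"
      by (rule integrable_compact_support_mult[OF A, of _ "\<lambda>x. (\<psi> x) ^ m *\<^sub>R grad \<psi> x" R])
         (auto intro!: continuous_intros \<psi>D simp: R)
    show "integrable lborel (\<lambda>x. norm (A x) * norm (G x) * norm ((\<psi> x) ^ Suc m))"
      by (rule integrable_compact_support_mult[OF AG, of _ "\<lambda>x. (\<psi> x) ^ Suc m" R])
         (auto intro!: continuous_intros \<psi>D simp: R)
  qed
  have Qle: "norm (Q w x) \<le> Dom x" if w: "0 \<le> w x" "w x \<le> 1" for w x
  proof -
    have pw: "(\<psi> x * w x) ^ i * w x \<le> \<psi> x ^ i" for i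
    proof -
      have "(\<psi> x * w x) ^ i * w x \<le> (\<psi> x * 1) ^ i * 1"
        using w \<psi>(2)[of x] by (intro mult_mono power_mono mult_left_mono) auto
      then show ?thesis by simp
    qed
    have nn: "0 \<le> (\<psi> x * w x) ^ i * w x" for i using w \<psi>(2)[of x] by simp
    have "norm (Q w x) \<le> norm ((\<psi> x * w x) ^ m * w x * (A x \<bullet> grad \<psi> x))
        + norm ((\<psi> x * w x) ^ Suc m * w x * (A x \<bullet> G x))"
      unfolding Q_def by (rule norm_triangle_ineq4)
    also have "\<dots> = (\<psi> x * w x) ^ m * w x * \<bar>A x \<bullet> grad \<psi> x\<bar> + (\<psi> x * w x) ^ Suc m * w x * \<bar>A x \<bullet> G x\<bar>"
      unfolding real_norm_def abs_mult[of _ "A x \<bullet> grad \<psi> x"] abs_mult[of _ "A x \<bullet> G x"] abs_of_nonneg[OF nn] ..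
    also have "\<dots> \<le> \<psi> x ^ m * (norm (A x) * norm (grad \<psi> x)) + \<psi> x ^ Suc m * (norm (A x) * norm (G x))"
      using nn \<psi>(2)[of x] by (intro add_mono mult_mono pw Cauchy_Schwarz_ineq2) auto
    also have "\<dots> = Dom x" using \<psi>(2)[of x] by (simp add: Dom_def mult_ac abs_mult)
    finally show ?thesis .
  qed
  have Qm[measurable]: "Q w0 \<in> borel_measurable borel" "Q (w j) \<in> borel_measurable borel" for j
    unfolding Q_def by measurable
  have intQ: "integrable lborel (Q v)"
    if [measurable]: "Q v \<in> borel_measurable borel" and v: "\<And>x. 0 \<le> v x" "\<And>x. v x \<le> 1" for v
  proof (rule Bochner_Integration.integrable_bound[OF intDom])
    show "AE x in lborel. norm (Q v x) \<le> norm (Dom x)"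
      using Qle v by (intro AE_I2) (force intro: order_trans[OF _ abs_ge_self])
  qed simp
  have Qint: "integrable lborel (Q (w j))" for j by (intro intQ Qm w1)
  show ?integrable using intQ[OF Qm(1) w01] by (simp add: Q_def[abs_def] V_def w0_def)
  have Qlim: "(\<lambda>j. \<integral>x. Q (w j) x \<partial>lborel) \<longlonglongrightarrow> (\<integral>x. Q w0 x \<partial>lborel)"
  proof (rule integral_dominated_convergence[OF _ _ intDom])
    show "AE x in lborel. (\<lambda>j. Q (w j) x) \<longlonglongrightarrow> Q w0 x"
      unfolding Q_def by (intro AE_I2 tendsto_intros lim_w)
    show "AE x in lborel. norm (Q (w j) x) \<le> Dom x" for j
      using Qle w1 by (intro AE_I2) auto
  qed auto
  \<comment> \<open>The tested inequality for the mollified quotient is \<open>0 \<le> \<integral> (Q (w j) - E j)\<close>.\<close>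
  have key: "integrable lborel (E j)" "0 \<le> (\<integral>x. Q (w j) x \<partial>lborel) - (\<integral>x. E j x \<partial>lborel)" for j
  proof -
    define \<phi> where "\<phi> x = (\<psi> x * w j x) ^ Suc m" for x
    have \<phi>: "\<phi> \<in> C1c UNIV" and g\<phi>: "grad \<phi> = (\<lambda>x. real (Suc m) *\<^sub>R
      (((\<psi> x * w j x) ^ m * w j x) *\<^sub>R grad \<psi> x - ((\<psi> x * w j x) ^ Suc m * w j x) *\<^sub>R H j x))"
      using C1c_test_quotient[OF \<psi>(1) mollify_weak_gradient(1)[OF kC u(1) G] mollify_weak_gradient(2)[OF kC u(1) G] moll0, of j m]
      unfolding \<phi>_def[abs_def] w_def H_def by blast+
    have eq: "A x \<bullet> grad \<phi> x = real (Suc m) * (Q (w j) x - E j x)" for x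
      unfolding g\<phi> Q_def E_def by (simp add: inner_diff_right algebra_simps)
    obtain R' where R': "R' > 0" "\<And>x. norm x > R' \<Longrightarrow> \<phi> x = 0" "\<And>x. norm x > R' \<Longrightarrow> grad \<phi> x = 0"
      using C1c_bounded_support[OF \<phi>] by blast
    have [measurable]: "grad \<phi> \<in> borel_measurable borel"
      using C1cD(2)[OF \<phi>] by (rule borel_measurable_continuous_onI)
    have "integrable lborel (\<lambda>x. A x \<bullet> grad \<phi> x)"
      by (rule integrable_compact_support_mult[OF A, of _ "grad \<phi>" R'])
         (auto intro!: C1cD(2)[OF \<phi>] R' Cauchy_Schwarz_ineq2)
    then have "integrable lborel (\<lambda>x. Q (w j) x - inverse (real (Suc m)) * (A x \<bullet> grad \<phi> x))"
      using Qint by auto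
    moreover have "inverse (real (Suc m)) * (real (Suc m) * y) = y" for y
      by (simp add: mult.assoc[symmetric] del: of_nat_Suc)
    ultimately have "integrable lborel (\<lambda>x. E j x)" unfolding eq by (simp del: of_nat_Suc)
    then show Ei: "integrable lborel (E j)" .
    have "0 \<le> (\<integral>x. A x \<bullet> grad \<phi> x \<partial>lborel)"
      by (rule test[OF \<phi>]) (use w1 \<psi>(2) in \<open>auto simp: \<phi>_def\<close>)
    also have "\<dots> = real (Suc m) * ((\<integral>x. Q (w j) x \<partial>lborel) - (\<integral>x. E j x \<partial>lborel))"
      unfolding eq using Qint Ei by simp
    finally show "0 \<le> (\<integral>x. Q (w j) x \<partial>lborel) - (\<integral>x. E j x \<partial>lborel)"
      by (simp add: zero_le_mult_iff)
  qed
  obtain B where B: "B > 0" "\<And>x. \<psi> x \<le> B"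
  proof -
    have "compact (\<psi> ` cball 0 R)"
      by (intro compact_continuous_image continuous_on_subset[OF \<psi>D(3)]) auto
    then obtain B where "\<And>x. norm x \<le> R \<Longrightarrow> norm (\<psi> x) \<le> B"
      using compact_imp_bounded[of "\<psi> ` cball 0 R"] unfolding bounded_iff by (metis imageI mem_cball_0)
    then have "\<psi> x \<le> max B 1" for x
      using R(2)[of x] by (cases "norm x \<le> R") (force simp: max_def)+
    then show ?thesis by (intro that[of "max B 1"]) auto
  qed
  have Elim: "(\<lambda>j. \<integral>x. E j x \<partial>lborel) \<longlonglongrightarrow> 0"
  proof (rule tendstoI)
    fix e :: real assume "e > 0"
    define e' where "e' = e / 2 / B ^ Suc m"
    have e': "e' > 0" using \<open>e > 0\<close> B by (simp add: e'_def)
    obtain s where s: "s > 0" "\<And>y. norm y < s \<Longrightarrow>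
      (\<integral>\<^sup>+x. ennreal (indicator (cball 0 R) x * norm (A x) * norm (G (x + y) - G x)) \<partial>lborel) \<le> ennreal e'"
      using trans[OF e', of R] by blast
    have "\<forall>\<^sub>F j in sequentially. d j < s" using d s(1) by (rule order_tendstoD)
    then show "\<forall>\<^sub>F j in sequentially. dist (\<integral>x. E j x \<partial>lborel) 0 < e"
    proof eventually_elim
      case (elim j)
      have le: "norm (E j x) \<le> B ^ Suc m * (indicator (cball 0 R) x * norm (A x) * norm (H j x - G x))" for x
      proof (cases "norm x \<le> R")
        case True
        have "norm (E j x) = (\<psi> x * w j x) ^ Suc m * w j x * \<bar>A x \<bullet> (H j x - G x)\<bar>"
        proof -
          have "0 \<le> (\<psi> x * w j x) ^ Suc m * w j x" using \<psi>(2)[of x] w1[of j x] by simp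
          then show ?thesis
            unfolding E_def real_norm_def abs_mult[of _ "A x \<bullet> (H j x - G x)"] by (simp only: abs_of_nonneg)
        qed
        also have "\<dots> \<le> (B * 1) ^ Suc m * 1 * (norm (A x) * norm (H j x - G x))"
          using \<psi>(2)[of x] w1[of j x] B
          by (intro mult_mono power_mono Cauchy_Schwarz_ineq2) auto
        finally show ?thesis using True by simp
      qed (simp add: E_def R)
      have "ennreal (norm (\<integral>x. E j x \<partial>lborel)) \<le> (\<integral>\<^sup>+x. ennreal (norm (E j x)) \<partial>lborel)"
        by (rule integral_norm_bound_ennreal[OF key(1)])
      also have "\<dots> \<le> (\<integral>\<^sup>+x. ennreal (B ^ Suc m) * ennreal (indicator (cball 0 R) x * norm (A x) * norm (H j x - G x)) \<partial>lborel)"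
        using le B by (intro nn_integral_mono) (auto intro!: ennreal_leI simp flip: ennreal_mult simp del: power_Suc)
      also have "\<dots> = ennreal (B ^ Suc m) * (\<integral>\<^sup>+x. ennreal (indicator (cball 0 R) x * norm (A x) * norm (H j x - G x)) \<partial>lborel)"
        by (rule nn_integral_cmult) measurable
      also have "\<dots> \<le> ennreal (B ^ Suc m) * ennreal e'"
        unfolding H_def using s(2) elim
        by (intro mult_left_mono mollify_weighted_error[OF k Gloc]) auto
      also have "\<dots> = ennreal (e / 2)"
        using B e' by (simp add: e'_def flip: ennreal_mult del: power_Suc)
      finally have "norm (\<integral>x. E j x \<partial>lborel) \<le> e / 2" using \<open>e > 0\<close> by simp
      then show ?case using \<open>e > 0\<close> by (simp add: dist_norm)
    qed
  qed
  have "0 \<le> (\<integral>x. Q w0 x \<partial>lborel) - 0"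
    by (rule tendsto_lowerbound[OF tendsto_diff[OF Qlim Elim]]) (use key(2) in auto)
  then show ?nonneg by (simp add: Q_def[abs_def] V_def w0_def)
qed

section \<open>Logarithmic cutoff functions\<close>

text \<open>This \<open>C\<^sup>1\<close> radial function equals \<open>1\<close> on the unit ball and \<open>0\<close> where \<open>x \<bullet> x \<ge> 2\<close>, so its gradient lives
  in an annulus of ratio less than \<open>2\<close>.\<close>

definition smooth_step :: "'a::euclidean_space \<Rightarrow> real" where
  "smooth_step x = pos_sq (1 - pos_sq (x \<bullet> x - 1))"

lemma pos_sq_le_1: "t \<le> 1 \<Longrightarrow> pos_sq t \<le> 1"
  by (auto simp: pos_sq_def max_def intro!: power_le_one)

lemma smooth_step_bounds: "0 \<le> smooth_step x" "smooth_step x \<le> 1"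
  by (auto simp: smooth_step_def pos_sq_nonneg intro!: pos_sq_le_1)

lemma smooth_step_eq_1: "norm x \<le> 1 \<Longrightarrow> smooth_step x = 1"
proof -
  assume "norm x \<le> 1"
  then have "x \<bullet> x \<le> 1" by (simp add: norm_le_square)
  then show ?thesis by (simp add: smooth_step_def pos_sq_eq_0) (simp add: pos_sq_def)
qed

text \<open>Twice the derivative of the radial profile with respect to \<open>s = x \<bullet> x\<close>.\<close>

definition smooth_step_slope :: "real \<Rightarrow> real" where
  "smooth_step_slope s = 2 * (2 * max 0 (1 - pos_sq (s - 1)) * (- (2 * max 0 (s - 1))))"

lemma pos_sq_ge_1: "t \<ge> 1 \<Longrightarrow> pos_sq t \<ge> 1"
  by (simp add: pos_sq_def)

lemma smooth_step_slope_eq_0: "s \<le> 1 \<or> s \<ge> 2 \<Longrightarrow> smooth_step_slope s = 0"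
  using pos_sq_ge_1[of "s - 1"] by (auto simp: smooth_step_slope_def)

lemma GDERIV_smooth_step: "GDERIV smooth_step x :> smooth_step_slope (x \<bullet> x) *\<^sub>R x"
  unfolding smooth_step_def smooth_step_slope_def
proof (rule GDERIV_radial[of "\<lambda>s. pos_sq (1 - pos_sq (s - 1))"])
  have "((\<lambda>s. s - 1) has_field_derivative 1) (at (x \<bullet> x))"
    by (auto intro!: derivative_eq_intros)
  from DERIV_chain2[OF pos_sq_has_derivative this]
  have "((\<lambda>s. 1 - pos_sq (s - 1)) has_field_derivative - (2 * max 0 (x \<bullet> x - 1))) (at (x \<bullet> x))"
    using DERIV_diff[OF DERIV_const[of 1]] by fastforce
  from DERIV_chain2[OF pos_sq_has_derivative this]
  show "((\<lambda>s. pos_sq (1 - pos_sq (s - 1))) has_field_derivative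
     2 * max 0 (1 - pos_sq (x \<bullet> x - 1)) * (- (2 * max 0 (x \<bullet> x - 1)))) (at (x \<bullet> x))" .
qed

lemma continuous_on_pos_sq: "continuous_on S f \<Longrightarrow> continuous_on S (\<lambda>x. pos_sq (f x))"
  unfolding pos_sq_def by (intro continuous_intros)

lemma norm_smooth_step_slope: "norm (smooth_step_slope (x \<bullet> x) *\<^sub>R x) \<le> 16"
proof (cases "x \<bullet> x \<le> 1 \<or> x \<bullet> x \<ge> 2")
  case True
  then show ?thesis by (simp add: smooth_step_slope_eq_0)
next
  case False
  then have "norm x \<le> 2" by (intro norm_le_square[THEN iffD2]) (auto simp: power2_eq_square)
  have "\<bar>smooth_step_slope (x \<bullet> x)\<bar> = 8 * (max 0 (1 - pos_sq (x \<bullet> x - 1)) * max 0 (x \<bullet> x - 1))"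
    by (simp add: smooth_step_slope_def abs_mult)
  also have "\<dots> \<le> 8 * (1 * 1)"
    using False pos_sq_nonneg[of "x \<bullet> x - 1"] by (intro mult_left_mono mult_mono) auto
  finally have "\<bar>smooth_step_slope (x \<bullet> x)\<bar> * norm x \<le> 8 * 2"
    using \<open>norm x \<le> 2\<close> by (intro mult_mono) auto
  then show ?thesis by simp
qed

text \<open>An average of \<open>m\<close> dyadic rescalings. It is a discrete version of the cutoff that is linear in
  \<open>ln (norm x)\<close>: the annuli carrying the gradients of the summands are disjoint, and each
  summand contributes an equal amount to the Dirichlet energy in the critical exponent.\<close>

definition log_cutoff :: "nat \<Rightarrow> 'a::euclidean_space \<Rightarrow> real" where
  "log_cutoff m x = (\<Sum>j<m. smooth_step (inverse (2 ^ (m + j)) *\<^sub>R x)) / real m"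

lemma log_cutoff_bounds: "0 \<le> log_cutoff m x" "log_cutoff m x \<le> 1"
proof -
  show "0 \<le> log_cutoff m x" by (auto simp: log_cutoff_def smooth_step_bounds intro!: sum_nonneg divide_nonneg_nonneg)
  have "(\<Sum>j<m. smooth_step (inverse (2 ^ (m + j)) *\<^sub>R x)) \<le> (\<Sum>j<m. 1)"
    by (intro sum_mono smooth_step_bounds)
  then show "log_cutoff m x \<le> 1" by (cases "m = 0") (auto simp: log_cutoff_def divide_simps)
qed

lemma log_cutoff_eq_1:
  assumes "m > 0" "norm x \<le> 2 ^ m" shows "log_cutoff m x = 1"
proof -
  have "smooth_step (inverse (2 ^ (m + j)) *\<^sub>R x) = 1" for j
  proof (rule smooth_step_eq_1)
    have "(2::real) ^ m \<le> 2 ^ (m + j)" by (intro power_increasing) auto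
    then have "norm x \<le> 2 ^ (m + j)" using assms(2) by (rule order_trans[rotated])
    then show "norm (inverse (2 ^ (m + j)) *\<^sub>R x) \<le> 1" by (simp add: field_simps)
  qed
  then show ?thesis using assms by (simp add: log_cutoff_def)
qed

text \<open>The gradient of the \<open>j\<close>-th summand before division by \<open>m\<close>.\<close>

definition log_cutoff_grad :: "nat \<Rightarrow> nat \<Rightarrow> 'a::euclidean_space \<Rightarrow> 'a" where
  "log_cutoff_grad m j x = (let l = inverse (2 ^ (m + j)) in
     l *\<^sub>R (smooth_step_slope ((l *\<^sub>R x) \<bullet> (l *\<^sub>R x)) *\<^sub>R (l *\<^sub>R x)))"

lemma log_cutoff_C1c:
  shows "log_cutoff m \<in> (C1c UNIV :: ('a::euclidean_space \<Rightarrow> real) set)"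
    and "grad (log_cutoff m) = (\<lambda>x::'a. (1 / real m) *\<^sub>R (\<Sum>j<m. log_cutoff_grad m j x))"
proof -
  have D1: "GDERIV (\<lambda>x. smooth_step (inverse (2 ^ (m + j)) *\<^sub>R x)) x :> log_cutoff_grad m j x" for j and x :: 'a
  proof -
    let ?l = "inverse (2 ^ (m + j)) :: real"
    have "((\<lambda>x. ?l *\<^sub>R x) has_derivative (\<lambda>h. ?l *\<^sub>R h)) (at x)"
      by (auto intro!: derivative_eq_intros)
    from has_derivative_compose[OF this GDERIV_smooth_step[of "?l *\<^sub>R x", unfolded gderiv_def]]
    show ?thesis by (simp add: gderiv_def log_cutoff_grad_def Let_def mult_ac)
  qed
  have D2: "GDERIV (\<lambda>x. \<Sum>j\<in>J. smooth_step (inverse (2 ^ (m + j)) *\<^sub>R x)) x :> (\<Sum>j\<in>J. log_cutoff_grad m j x)"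
    if "finite J" for J and x :: 'a
    using that by induction (auto intro!: GDERIV_add D1 GDERIV_const)
  have D: "GDERIV (log_cutoff m) x :> (1 / real m) *\<^sub>R (\<Sum>j<m. log_cutoff_grad m j x)" for x :: 'a
    using GDERIV_mult[OF GDERIV_const[of "1 / real m"] D2[of "{..<m}" x]]
    by (simp add: log_cutoff_def[abs_def])
  have c: "continuous_on UNIV (\<lambda>x::'a. (1 / real m) *\<^sub>R (\<Sum>j<m. log_cutoff_grad m j x))"
    unfolding log_cutoff_grad_def Let_def smooth_step_slope_def
    by (intro continuous_intros continuous_on_pos_sq)
  have z: "log_cutoff m x = 0" if "norm x > 2 * 2 ^ (m + m)" for x :: 'a
  proof -
    have "smooth_step (inverse (2 ^ (m + j)) *\<^sub>R x) = 0" if "j < m" for j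
    proof -
      let ?l = "inverse (2 ^ (m + j)) :: real"
      have "(2::real) ^ (m + j) \<le> 2 ^ (m + m)" using that by (intro power_increasing) auto
      then have "2 * 2 ^ (m + j) \<le> norm x" using \<open>norm x > 2 * 2 ^ (m + m)\<close> by linarith
      then have "2 \<le> norm (?l *\<^sub>R x)" by (simp add: field_simps)
      then have "2\<^sup>2 \<le> (norm (?l *\<^sub>R x))\<^sup>2" by (intro power_mono) auto
      then have "4 \<le> (?l *\<^sub>R x) \<bullet> (?l *\<^sub>R x)" by (simp only: power2_norm_eq_inner) simp
      then show ?thesis unfolding smooth_step_def
        using pos_sq_ge_1[of "(?l *\<^sub>R x) \<bullet> (?l *\<^sub>R x) - 1"] by (intro pos_sq_eq_0) simp
    qed
    then show ?thesis by (simp add: log_cutoff_def)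
  qed
  from C1cI[OF D c z] show "log_cutoff m \<in> (C1c UNIV :: ('a \<Rightarrow> real) set)"
    and "grad (log_cutoff m) = (\<lambda>x::'a. (1 / real m) *\<^sub>R (\<Sum>j<m. log_cutoff_grad m j x))"
    by blast+
qed

lemma log_cutoff_grad_annulus:
  assumes "log_cutoff_grad m j x \<noteq> 0"
  shows "2 ^ (m + j) < norm x" "norm x < 2 * 2 ^ (m + j)"
proof -
  let ?L = "2 ^ (m + j) :: real"
  have "smooth_step_slope ((inverse ?L *\<^sub>R x) \<bullet> (inverse ?L *\<^sub>R x)) \<noteq> 0"
    using assms by (auto simp: log_cutoff_grad_def Let_def)
  then have "1 < (inverse ?L *\<^sub>R x) \<bullet> (inverse ?L *\<^sub>R x)" "(inverse ?L *\<^sub>R x) \<bullet> (inverse ?L *\<^sub>R x) < 2"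
    using smooth_step_slope_eq_0 by (meson not_le)+
  moreover have "(inverse ?L *\<^sub>R x) \<bullet> (inverse ?L *\<^sub>R x) = (norm x)\<^sup>2 / ?L\<^sup>2"
    by (simp add: dot_square_norm divide_inverse power2_eq_square mult_ac)
  ultimately have "1 < (norm x)\<^sup>2 / ?L\<^sup>2" "(norm x)\<^sup>2 / ?L\<^sup>2 < 2" by (simp_all only:)
  then have *: "?L\<^sup>2 < (norm x)\<^sup>2" "(norm x)\<^sup>2 < 2 * ?L\<^sup>2"
    by (simp_all add: pos_less_divide_eq pos_divide_less_eq)
  show "?L < norm x" using *(1) by (rule power_less_imp_less_base) simp
  have "(norm x)\<^sup>2 < 2 * ?L\<^sup>2" by fact
  also have "\<dots> \<le> (2 * ?L)\<^sup>2" by (simp add: power2_eq_square)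
  finally have "(norm x)\<^sup>2 < (2 * ?L)\<^sup>2" .
  then show "norm x < 2 * ?L" by (rule power_less_imp_less_base) simp
qed

lemma norm_log_cutoff_grad_le:
  "norm (log_cutoff_grad m j x) \<le> 16 / 2 ^ (m + j) * indicator (cball 0 (2 * 2 ^ (m + j))) x"
proof (cases "log_cutoff_grad m j x = 0")
  case False
  let ?l = "inverse (2 ^ (m + j)) :: real"
  have "norm (log_cutoff_grad m j x) = ?l * norm (smooth_step_slope ((?l *\<^sub>R x) \<bullet> (?l *\<^sub>R x)) *\<^sub>R (?l *\<^sub>R x))"
  proof -
    have "norm (?l *\<^sub>R z) = ?l * norm z" for z :: 'a by simp
    then show ?thesis unfolding log_cutoff_grad_def Let_def by blast
  qed
  also have "\<dots> \<le> ?l * 16" by (intro mult_left_mono norm_smooth_step_slope) auto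
  finally show ?thesis using log_cutoff_grad_annulus(2)[OF False] by (simp add: divide_inverse)
qed simp

lemma log_cutoff_grad_disjoint:
  assumes "log_cutoff_grad m i x \<noteq> 0" "log_cutoff_grad m j x \<noteq> 0"
  shows "i = j"
proof -
  have False if "i < j" "log_cutoff_grad m i x \<noteq> 0" "log_cutoff_grad m j x \<noteq> 0" for i j
  proof -
    have "(2::real) * 2 ^ (m + i) = 2 ^ (m + Suc i)" by simp
    also have "\<dots> \<le> 2 ^ (m + j)" using that by (intro power_increasing) auto
    also have "\<dots> < norm x" using log_cutoff_grad_annulus(1) that by blast
    finally show False using log_cutoff_grad_annulus(2)[OF that(2)] by simp
  qed
  then show ?thesis using assms by (metis linorder_neqE_nat)
qed

lemma norm_sum_powr_le:
  fixes a :: "'i \<Rightarrow> 'b::real_normed_vector"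
  assumes "finite I" "\<And>i j. i \<in> I \<Longrightarrow> j \<in> I \<Longrightarrow> a i \<noteq> 0 \<Longrightarrow> a j \<noteq> 0 \<Longrightarrow> i = j"
  shows "norm (\<Sum>i\<in>I. a i) powr r \<le> (\<Sum>i\<in>I. norm (a i) powr r)"
proof (cases "\<exists>i\<in>I. a i \<noteq> 0")
  case True
  then obtain i where i: "i \<in> I" "a i \<noteq> 0" by blast
  have "(\<Sum>i\<in>I. a i) = a i + (\<Sum>j\<in>I - {i}. a j)" using assms(1) i(1) by (rule sum.remove)
  also have "(\<Sum>j\<in>I - {i}. a j) = 0" using assms(2) i by (intro sum.neutral) blast
  finally have "norm (\<Sum>i\<in>I. a i) powr r = norm (a i) powr r" by simp
  also have "\<dots> \<le> (\<Sum>i\<in>I. norm (a i) powr r)"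
    using assms(1) i(1) by (intro member_le_sum) auto
  finally show ?thesis .
qed (auto simp: sum_nonneg)

text \<open>On the \<open>j\<close>-th annulus, of radius \<open>L j\<close>, the gradient is at most \<open>16 / (m L j)\<close> and the
  volume is of order \<open>L j ^ DIM('a)\<close>. For \<open>r \<ge> DIM('a)\<close> each annulus therefore contributes at most a
  constant times \<open>m powr (- r)\<close>, and there are \<open>m\<close> of them. Since \<open>r > 1\<close> in the application, the
  energy vanishes in the limit even in the critical case \<open>r = DIM('a)\<close>, where a single rescaled
  cutoff would only give boundedness.\<close>

lemma integral_grad_log_cutoff_le:
  fixes r :: real
  assumes r: "r \<ge> real DIM('a::euclidean_space)" and m: "m > 0"
  shows "(\<integral>x. norm (grad (log_cutoff m) (x::'a)) powr r \<partial>lborel)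
    \<le> (16 powr r * 2 ^ DIM('a) * measure lborel (ball (0::'a) 1)) * real m powr (1 - r)"
proof -
  let ?g = "grad (log_cutoff m) :: 'a \<Rightarrow> 'a"
  define L where "L j = (2 ^ (m + j) :: real)" for j
  have L: "L j \<ge> 1" for j by (simp add: L_def)
  define w where "w = measure lborel (ball (0::'a) 1)"
  have r1: "r > 0" using r DIM_positive[where 'a='a] by (metis of_nat_0_less_iff order_less_le_trans)
  have pw: "norm (?g x) powr r \<le> real m powr (- r) * (\<Sum>j<m. (16 / L j) powr r * indicator (cball 0 (2 * L j)) x)" for x
  proof -
    have "norm (?g x) powr r = (1 / real m) powr r * norm (\<Sum>j<m. log_cutoff_grad m j x) powr r"
    proof -
      have "norm (?g x) = (1 / real m) * norm (\<Sum>j<m. log_cutoff_grad m j x)"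
        unfolding log_cutoff_C1c(2) by simp
      then show ?thesis by (simp only: powr_mult)
    qed
    also have "(1 / real m) powr r = real m powr (- r)"
      by (subst powr_divide) (simp_all add: powr_minus_divide)
    also have "norm (\<Sum>j<m. log_cutoff_grad m j x) powr r \<le> (\<Sum>j<m. norm (log_cutoff_grad m j x) powr r)"
      by (rule norm_sum_powr_le) (auto dest: log_cutoff_grad_disjoint)
    also have "\<dots> \<le> (\<Sum>j<m. (16 / L j) powr r * indicator (cball 0 (2 * L j)) x)"
    proof (rule sum_mono)
      fix j
      show "norm (log_cutoff_grad m j x) powr r \<le> (16 / L j) powr r * indicator (cball 0 (2 * L j)) x"
        using norm_log_cutoff_grad_le[of m j x] r1 unfolding L_def[symmetric]
        by (cases "x \<in> cball 0 (2 * L j)") (auto intro!: powr_mono2)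
    qed
    finally show ?thesis by (simp add: mult_left_mono)
  qed
  have intj: "integrable lborel (\<lambda>x. (16 / L j) powr r * indicator (cball 0 (2 * L j)) (x::'a))" for j
    using emeasure_lborel_cball_finite[of "0::'a" "2 * L j"]
    by (intro integrable_mult_right integrable_real_indicator) auto
  have "(\<integral>x. norm (?g x) powr r \<partial>lborel)
      \<le> (\<integral>x. real m powr (- r) * (\<Sum>j<m. (16 / L j) powr r * indicator (cball (0::'a) (2 * L j)) x) \<partial>lborel)"
  proof (rule Bochner_Integration.integral_mono')
    show "integrable lborel (\<lambda>x::'a. real m powr (- r) * (\<Sum>j<m. (16 / L j) powr r * indicator (cball 0 (2 * L j)) x))"
      by (intro integrable_mult_right Bochner_Integration.integrable_sum intj)
    show "0 \<le> real m powr (- r) * (\<Sum>j<m. (16 / L j) powr r * indicator (cball 0 (2 * L j)) x)" for x :: 'a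
      by (intro mult_nonneg_nonneg sum_nonneg) auto
  qed (rule pw)
  also have "\<dots> = real m powr (- r) * (\<Sum>j<m. (16 / L j) powr r * measure lborel (cball 0 (2 * L j) :: 'a set))"
  proof -
    have "(\<integral>x. (\<Sum>j<m. (16 / L j) powr r * indicator (cball (0::'a) (2 * L j)) x) \<partial>lborel)
        = (\<Sum>j<m. \<integral>x. (16 / L j) powr r * indicator (cball (0::'a) (2 * L j)) x \<partial>lborel)"
      by (rule Bochner_Integration.integral_sum) (rule intj)
    also have "\<dots> = (\<Sum>j<m. (16 / L j) powr r * measure lborel (cball (0::'a) (2 * L j)))"
      by (simp del: times_divide_eq_left)
    finally show ?thesis by (simp only: integral_mult_right_zero)
  qed
  also have "\<dots> \<le> real m powr (- r) * (\<Sum>j<m. 16 powr r * 2 ^ DIM('a) * w)"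
  proof (intro mult_left_mono sum_mono)
    fix j
    have "measure lborel (cball 0 (2 * L j) :: 'a set) = (2 * L j) ^ DIM('a) * w"
      using L[of j] content_ball_conv_unit_ball[of "2 * L j" "0::'a"] content_cball_conv_ball[of "0::'a" "2 * L j"]
      by (simp add: w_def)
    then have "(16 / L j) powr r * measure lborel (cball 0 (2 * L j) :: 'a set)
        = 16 powr r * 2 ^ DIM('a) * w * (L j ^ DIM('a) / L j powr r)"
      using L[of j] by (simp add: powr_divide power_mult_distrib)
    also have "L j ^ DIM('a) = L j powr real DIM('a)" using L[of j] by (simp add: powr_realpow)
    also have "\<dots> / L j powr r \<le> 1"
      using L[of j] r by (simp add: divide_le_eq_1 powr_mono)
    finally show "(16 / L j) powr r * measure lborel (cball 0 (2 * L j) :: 'a set) \<le> 16 powr r * 2 ^ DIM('a) * w"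
      by (simp add: w_def mult_left_le)
  qed auto
  also have "\<dots> = (16 powr r * 2 ^ DIM('a) * w) * real m powr (1 - r)"
    using m by (simp add: powr_diff powr_minus divide_inverse)
  finally show ?thesis unfolding w_def .
qed

section \<open>The Caccioppoli estimate and the vanishing of the gradient\<close>

text \<open>Young's inequality with a crude constant, by distinguishing whether \<open>b\<close> is at most \<open>a / 2\<close>.\<close>

lemma powr_young:
  fixes a b r :: real
  assumes "0 \<le> a" "0 \<le> b" "r \<ge> 1"
  shows "a powr (r - 1) * b \<le> a powr r / 2 + 2 powr (r - 1) * b powr r"
proof -
  have split: "x powr r = x powr (r - 1) * x" if "x \<ge> 0" for x :: real
    using powr_mult_base[OF that, of "r - 1"] by (simp add: mult.commute)
  show ?thesis
  proof (cases "2 * b \<le> a")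
    case True
    then have "a powr (r - 1) * b \<le> a powr (r - 1) * (a / 2)" by (intro mult_left_mono) auto
    also have "\<dots> = a powr r / 2" using split[OF assms(1)] by simp
    finally show ?thesis by (simp add: add_increasing2)
  next
    case False
    then have "a powr (r - 1) * b \<le> (2 * b) powr (r - 1) * b"
      using assms by (intro mult_right_mono powr_mono2) auto
    also have "\<dots> = 2 powr (r - 1) * b powr r" using split[OF assms(2)] assms by (simp add: powr_mult)
    finally show ?thesis using assms by (simp add: add_increasing)
  qed
qed

text \<open>Young's inequality for \<open>a = V * g\<close> and \<open>b = s\<close>, multiplied by \<open>V powr (Suc m - r) * w\<close>. Since
  \<open>V\<close> and \<open>w\<close> are at most \<open>1\<close>, one exponent \<open>m\<close> serves all \<open>r\<close> up to \<open>m\<close>; this is what allows the two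
  operators to be treated with the same test function.\<close>

lemma caccioppoli_pointwise:
  fixes V w g s r :: real
  assumes "0 \<le> V" "V \<le> 1" "0 \<le> w" "w \<le> 1" "0 \<le> g" "0 \<le> s" "1 \<le> r" "r \<le> real m"
  shows "V ^ m * w * (g powr (r - 1) * s) \<le> V ^ Suc m * w * g powr r / 2 + 2 powr (r - 1) * s powr r"
proof (cases "V = 0")
  case True
  then show ?thesis using assms by (simp add: power_0_left)
next
  case False
  then have V: "V > 0" using assms by simp
  define c where "c = V powr (real (Suc m) - r) * w"
  have c: "0 \<le> c" "c \<le> 1"
    using V assms unfolding c_def by (auto intro!: mult_le_one powr_le1)
  have Vm: "V ^ i = V powr real i" for i using V by (simp add: powr_realpow)
  have "V ^ m * w * (g powr (r - 1) * s) = c * ((V * g) powr (r - 1) * s)"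
    using V assms by (simp add: c_def Vm powr_mult algebra_simps flip: powr_add)
  also have "\<dots> \<le> c * ((V * g) powr r / 2 + 2 powr (r - 1) * s powr r)"
    using V assms c by (intro mult_left_mono powr_young) auto
  also have "\<dots> = V ^ Suc m * w * g powr r / 2 + c * (2 powr (r - 1) * s powr r)"
    using V assms by (simp add: c_def Vm powr_mult algebra_simps flip: powr_add del: power_Suc)
  also have "c * (2 powr (r - 1) * s powr r) \<le> 2 powr (r - 1) * s powr r"
    using c by (intro mult_left_le_one_le) auto
  finally show ?thesis by simp
qed

lemma loc_integrable_powr_le:
  fixes G :: "'a::euclidean_space \<Rightarrow> 'b::euclidean_space"
  assumes [measurable]: "G \<in> borel_measurable borel" and "loc_integrable (\<lambda>x. norm (G x) powr r)"
    and s: "0 \<le> s" "s \<le> r"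
  shows "loc_integrable (\<lambda>x. norm (G x) powr s)"
proof (rule loc_integrable_bound)
  show "loc_integrable (\<lambda>x. 1 + norm (G x) powr r)"
    by (intro loc_integrable_add loc_integrable_continuous assms) auto
  fix x
  have "norm (G x) powr s \<le> 1 + norm (G x) powr r"
  proof (cases "norm (G x) \<le> 1")
    case True
    then have "norm (G x) powr s \<le> 1" using s by (intro powr_le1) auto
    then show ?thesis by (simp add: add_increasing2)
  next
    case False
    then have "norm (G x) powr s \<le> norm (G x) powr r" using s by (intro powr_mono) auto
    then show ?thesis by simp
  qed
  then show "norm (norm (G x) powr s) \<le> norm (1 + norm (G x) powr r)" by simp
qed measurable

definition pq_flux :: "real \<Rightarrow> real \<Rightarrow> 'a::euclidean_space \<Rightarrow> 'a" where
  "pq_flux p q z = (norm z powr (p - 2)) *\<^sub>R z + (norm z powr (q - 2)) *\<^sub>R z"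

lemma pq_flux_norm: "norm (pq_flux p q z) \<le> norm z powr (p - 1) + norm z powr (q - 1)"
proof -
  have "norm ((norm z powr (r - 2)) *\<^sub>R z) = norm z powr (r - 1)" for r
    using powr_mult_base[of "norm z" "r - 2"] by (simp add: mult.commute algebra_simps)
  then show ?thesis unfolding pq_flux_def using norm_triangle_ineq by metis
qed

lemma pq_flux_inner: "pq_flux p q z \<bullet> z = norm z powr p + norm z powr q"
proof -
  have "((norm z powr (r - 2)) *\<^sub>R z) \<bullet> z = norm z powr r" for r
  proof -
    have "((norm z powr (r - 2)) *\<^sub>R z) \<bullet> z = norm z * (norm z * norm z powr (r - 2))"
      by (simp add: dot_square_norm power2_eq_square)
    also have "\<dots> = norm z powr r" by (simp add: powr_mult_base)
    finally show ?thesis .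
  qed
  then show ?thesis by (simp only: pq_flux_def inner_add_left)
qed

text \<open>Fixing a Borel representative of the gradient makes functions such as \<open>G (x + y)\<close> jointly
  measurable, as Tonelli's theorem requires.\<close>

locale borel_supersolution =
  fixes p q :: real and u :: "'a::euclidean_space \<Rightarrow> real" and G :: "'a \<Rightarrow> 'a"
  assumes pq: "p > q" "q > 1"
    and u: "continuous_on UNIV u" "\<And>x. 0 \<le> u x"
    and G[measurable]: "G \<in> borel_measurable borel"
    and Gp: "loc_integrable (\<lambda>x. norm (G x) powr p)"
    and wG: "weak_gradient u G"
    and super: "\<And>\<phi>. \<phi> \<in> C1c UNIV \<Longrightarrow> (\<And>x. 0 \<le> \<phi> x) \<Longrightarrow> 0 \<le> (\<integral>x. pq_flux p q (G x) \<bullet> grad \<phi> x \<partial>lborel)"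
begin

lemma flux_measurable[measurable]: "(\<lambda>x. pq_flux p q (G x)) \<in> borel_measurable borel"
  unfolding pq_flux_def by measurable

lemma gradient_powr_loc_integrable: "0 \<le> s \<Longrightarrow> s \<le> p \<Longrightarrow> loc_integrable (\<lambda>x. norm (G x) powr s)"
  by (rule loc_integrable_powr_le[OF G Gp])

lemma flux_loc_integrable: "loc_integrable (\<lambda>x. pq_flux p q (G x))"
proof (rule loc_integrable_bound)
  show "loc_integrable (\<lambda>x. norm (G x) powr (p - 1) + norm (G x) powr (q - 1))"
    using pq by (intro loc_integrable_add gradient_powr_loc_integrable) auto
  show "norm (pq_flux p q (G x)) \<le> norm (norm (G x) powr (p - 1) + norm (G x) powr (q - 1))" for x
    using pq_flux_norm[of p q "G x"] by simp
qed measurable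

lemma flux_energy_loc_integrable: "loc_integrable (\<lambda>x. norm (pq_flux p q (G x)) * norm (G x))"
proof (rule loc_integrable_bound)
  show "loc_integrable (\<lambda>x. norm (G x) powr p + norm (G x) powr q)"
    using pq by (intro loc_integrable_add gradient_powr_loc_integrable) auto
  fix x
  have "norm (pq_flux p q (G x)) * norm (G x) \<le> (norm (G x) powr (p - 1) + norm (G x) powr (q - 1)) * norm (G x)"
    by (intro mult_right_mono pq_flux_norm) auto
  also have "\<dots> = norm (G x) powr p + norm (G x) powr q"
    using powr_mult_base[of "norm (G x)" "p - 1"] powr_mult_base[of "norm (G x)" "q - 1"]
    by (simp add: algebra_simps)
  finally show "norm (norm (pq_flux p q (G x)) * norm (G x)) \<le> norm (norm (G x) powr p + norm (G x) powr q)" 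
    by simp
qed measurable

lemma flux_translation_continuous:
  assumes e: "e > 0"
  shows "\<exists>d>0. \<forall>y. norm y < d \<longrightarrow>
      (\<integral>\<^sup>+x. ennreal (indicator (cball 0 R) x * norm (pq_flux p q (G x)) * norm (G (x + y) - G x)) \<partial>lborel) \<le> ennreal e"
proof -
  have e2: "e / 2 > 0" using e by simp
  obtain d1 where d1: "d1 > 0" "\<And>y. norm y < d1 \<Longrightarrow>
    (\<integral>\<^sup>+x. ennreal (indicator (cball 0 R) x * (norm (G x) powr (p - 1) * norm (G (x + y) - G x))) \<partial>lborel) \<le> ennreal (e / 2)"
    using powr_weighted_translation_continuous[OF G Gp _ e2, of R] pq by auto
  obtain d2 where d2: "d2 > 0" "\<And>y. norm y < d2 \<Longrightarrow>
    (\<integral>\<^sup>+x. ennreal (indicator (cball 0 R) x * (norm (G x) powr (q - 1) * norm (G (x + y) - G x))) \<partial>lborel) \<le> ennreal (e / 2)"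
    using powr_weighted_translation_continuous[OF G gradient_powr_loc_integrable _ e2, of q R] pq by auto
  have "(\<integral>\<^sup>+x. ennreal (indicator (cball 0 R) x * norm (pq_flux p q (G x)) * norm (G (x + y) - G x)) \<partial>lborel) \<le> ennreal e"
    if y: "norm y < min d1 d2" for y
  proof -
    have "(\<integral>\<^sup>+x. ennreal (indicator (cball 0 R) x * norm (pq_flux p q (G x)) * norm (G (x + y) - G x)) \<partial>lborel)
      \<le> (\<integral>\<^sup>+x. ennreal (indicator (cball 0 R) x * (norm (G x) powr (p - 1) * norm (G (x + y) - G x)))
          + ennreal (indicator (cball 0 R) x * (norm (G x) powr (q - 1) * norm (G (x + y) - G x))) \<partial>lborel)"
    proof (intro nn_integral_mono)
      fix x
      have "norm (pq_flux p q (G x)) * norm (G (x + y) - G x)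
        \<le> (norm (G x) powr (p - 1) + norm (G x) powr (q - 1)) * norm (G (x + y) - G x)"
        by (intro mult_right_mono pq_flux_norm) auto
      then show "ennreal (indicator (cball 0 R) x * norm (pq_flux p q (G x)) * norm (G (x + y) - G x))
        \<le> ennreal (indicator (cball 0 R) x * (norm (G x) powr (p - 1) * norm (G (x + y) - G x)))
          + ennreal (indicator (cball 0 R) x * (norm (G x) powr (q - 1) * norm (G (x + y) - G x)))"
        by (auto simp: indicator_def algebra_simps simp flip: ennreal_plus intro!: ennreal_leI)
    qed
    also have "\<dots> = (\<integral>\<^sup>+x. ennreal (indicator (cball 0 R) x * (norm (G x) powr (p - 1) * norm (G (x + y) - G x))) \<partial>lborel)
        + (\<integral>\<^sup>+x. ennreal (indicator (cball 0 R) x * (norm (G x) powr (q - 1) * norm (G (x + y) - G x))) \<partial>lborel)"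
      by (rule nn_integral_add) measurable
    also have "\<dots> \<le> ennreal (e / 2) + ennreal (e / 2)"
      using y by (intro add_mono d1(2) d2(2)) auto
    also have "\<dots> = ennreal e" using e by (simp flip: ennreal_plus)
    finally show ?thesis .
  qed
  then show ?thesis using d1(1) d2(1) by (intro exI[of _ "min d1 d2"]) auto
qed

text \<open>Both gradient terms of the tested inequality are absorbed by Young's inequality, half of each
  staying on the left. The bound no longer involves \<open>u\<close>, because dividing the cutoff by \<open>u + 1\<close>
  makes the powers of \<open>u + 1\<close> on the right nonpositive.\<close>

lemma caccioppoli:
  fixes m :: nat
  assumes m: "p \<le> real m" and \<psi>: "\<psi> \<in> C1c UNIV" "\<And>x. 0 \<le> \<psi> x" "\<And>x. \<psi> x \<le> 1"
  defines "F \<equiv> \<lambda>x. (\<psi> x * inverse (u x + 1)) ^ Suc m * inverse (u x + 1) * norm (G x) powr p"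
  shows "integrable lborel F"
    and "(\<integral>x. F x \<partial>lborel) \<le> 2 powr p * (\<integral>x. norm (grad \<psi> x) powr p \<partial>lborel)
            + 2 powr q * (\<integral>x. norm (grad \<psi> x) powr q \<partial>lborel)"
proof -
  note \<psi>D = C1cD[OF \<psi>(1)]
  obtain R where R: "R > 0" "\<And>x. norm x > R \<Longrightarrow> \<psi> x = 0" "\<And>x. norm x > R \<Longrightarrow> grad \<psi> x = 0"
    using C1c_bounded_support[OF \<psi>(1)] by blast
  define w where "w x = inverse (u x + 1)" for x
  define V where "V x = \<psi> x * w x" for x
  define A where "A x = pq_flux p q (G x)" for x
  have w: "0 \<le> w x" "w x \<le> 1" for x using u(2)[of x] by (auto simp: w_def inverse_le_1_iff)
  have V: "0 \<le> V x" "V x \<le> 1" for x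
    using w[of x] \<psi>(2,3)[of x] by (auto simp: V_def intro: mult_le_one)
  have contw: "continuous_on UNIV w"
    unfolding w_def by (rule continuous_on_inverse_add_one[OF u])
  have contV: "continuous_on UNIV V" unfolding V_def by (intro continuous_intros contw \<psi>D)
  have [measurable]: "w \<in> borel_measurable borel" "V \<in> borel_measurable borel" "\<psi> \<in> borel_measurable borel"
    using contw contV \<psi>D by (auto intro: borel_measurable_continuous_onI)
  define Q where "Q x = V x ^ m * w x * (A x \<bullet> grad \<psi> x) - V x ^ Suc m * w x * (A x \<bullet> G x)" for x
  have Q: "integrable lborel Q" "0 \<le> (\<integral>x. Q x \<partial>lborel)"
    using test_quotient_inequality[OF u wG flux_loc_integrable flux_energy_loc_integrable
        flux_translation_continuous super \<psi>(1,2), of m]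
    unfolding Q_def[abs_def] V_def w_def A_def by blast+
  define P where "P s x = V x ^ Suc m * w x * norm (G x) powr s" for s x
  have FP: "F = P p" by (simp add: fun_eq_iff F_def P_def V_def w_def)
  have intP: "integrable lborel (P s)" if "0 \<le> s" "s \<le> p" for s
    unfolding P_def[abs_def]
    by (rule integrable_compact_support_mult[OF gradient_powr_loc_integrable[OF that], of _ "\<lambda>x. V x ^ Suc m * w x" R])
       (auto intro!: continuous_intros contw \<psi>D simp: R V_def abs_mult)
  show "integrable lborel F" unfolding FP using pq by (intro intP) auto
  define S where "S s x = norm (grad \<psi> x) powr s" for s x
  have intS: "integrable lborel (S s)" if "s > 0" for s
    unfolding S_def[abs_def]
  proof (rule integrable_continuous_compact_support[of _ R])
    show "continuous_on UNIV (\<lambda>x. norm (grad \<psi> x) powr s)"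
      using that by (intro continuous_on_powr' continuous_on_norm continuous_on_const \<psi>D) auto
  qed (simp add: R)
  have pw: "Q x \<le> 2 powr (p - 1) * S p x + 2 powr (q - 1) * S q x - (P p x + P q x) / 2" for x
  proof -
    have "A x \<bullet> grad \<psi> x \<le> norm (A x) * norm (grad \<psi> x)" by (rule norm_cauchy_schwarz)
    also have "\<dots> \<le> (norm (G x) powr (p - 1) + norm (G x) powr (q - 1)) * norm (grad \<psi> x)"
      unfolding A_def by (intro mult_right_mono pq_flux_norm) auto
    finally have "V x ^ m * w x * (A x \<bullet> grad \<psi> x)
        \<le> V x ^ m * w x * ((norm (G x) powr (p - 1) + norm (G x) powr (q - 1)) * norm (grad \<psi> x))"
      using V w by (intro mult_left_mono) auto
    also have "\<dots> = V x ^ m * w x * (norm (G x) powr (p - 1) * norm (grad \<psi> x))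
        + V x ^ m * w x * (norm (G x) powr (q - 1) * norm (grad \<psi> x))" by (simp add: algebra_simps)
    also have "\<dots> \<le> (P p x / 2 + 2 powr (p - 1) * S p x) + (P q x / 2 + 2 powr (q - 1) * S q x)"
      unfolding P_def S_def using V[of x] w[of x] pq m by (intro add_mono caccioppoli_pointwise) auto
    finally have "V x ^ m * w x * (A x \<bullet> grad \<psi> x) \<le> (P p x / 2 + 2 powr (p - 1) * S p x) + (P q x / 2 + 2 powr (q - 1) * S q x)" .
    moreover have "V x ^ Suc m * w x * (A x \<bullet> G x) = P p x + P q x"
      unfolding A_def pq_flux_inner P_def by (rule distrib_left)
    moreover have "a - b \<le> s + t - (P1 + P2) / 2" if "a \<le> P1 / 2 + s + (P2 / 2 + t)" "b = P1 + P2"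
      for a b s t P1 P2 :: real using that by (simp add: field_simps)
    ultimately show ?thesis unfolding Q_def by blast
  qed
  have int: "integrable lborel (S p)" "integrable lborel (S q)" "integrable lborel (P p)" "integrable lborel (P q)"
    using pq by (auto intro!: intS intP)
  have "0 \<le> (\<integral>x. 2 powr (p - 1) * S p x + 2 powr (q - 1) * S q x - (P p x + P q x) / 2 \<partial>lborel)"
    using Q(2) by (rule order_trans) (intro integral_mono Q(1) pw; use int in auto)
  also have "\<dots> = 2 powr (p - 1) * (\<integral>x. S p x \<partial>lborel) + 2 powr (q - 1) * (\<integral>x. S q x \<partial>lborel)
      - ((\<integral>x. P p x \<partial>lborel) + (\<integral>x. P q x \<partial>lborel)) / 2"
    using int by simp
  finally have "(\<integral>x. P p x \<partial>lborel) + (\<integral>x. P q x \<partial>lborel)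
      \<le> 2 * 2 powr (p - 1) * (\<integral>x. S p x \<partial>lborel) + 2 * 2 powr (q - 1) * (\<integral>x. S q x \<partial>lborel)"
    by simp
  moreover have "0 \<le> (\<integral>x. P q x \<partial>lborel)"
    using V w by (intro Bochner_Integration.integral_nonneg) (simp add: P_def)
  moreover have "2 * 2 powr (s - 1) = (2::real) powr s" for s using powr_mult_base[of 2 "s - 1"] by simp
  ultimately show "(\<integral>x. F x \<partial>lborel) \<le> 2 powr p * (\<integral>x. norm (grad \<psi> x) powr p \<partial>lborel)
            + 2 powr q * (\<integral>x. norm (grad \<psi> x) powr q \<partial>lborel)"
    unfolding FP S_def[symmetric] by simp
qed

text \<open>Insert the logarithmic cutoffs into the Caccioppoli estimate: its right-hand side is of order
  \<open>M powr (1 - p) + M powr (1 - q)\<close>, while the left-hand side bounds a fixed positive weight times \<open>\<bar>G\<bar>\<^sup>p\<close>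
  on any given ball.\<close>

lemma gradient_eq_0:
  assumes dim: "q \<ge> real DIM('a)"
  shows "AE x in lborel. G x = 0"
proof -
  obtain m :: nat where m: "p \<le> real m" using real_arch_simple by blast
  define f where "f x = inverse (u x + 1) ^ Suc m * inverse (u x + 1) * norm (G x) powr p" for x
  define C where "C s = 2 powr s * (16 powr s * 2 ^ DIM('a) * measure lborel (ball (0::'a) 1))" for s :: real
  have [measurable]: "u \<in> borel_measurable borel" using u(1) by (rule borel_measurable_continuous_onI)
  have [measurable]: "f \<in> borel_measurable borel" unfolding f_def by measurable
  have upos: "inverse (u x + 1) > 0" for x using u(2)[of x] by simp
  have f0: "0 \<le> f x" for x using upos[of x] by (simp add: f_def)
  have ball: "AE x in lborel. x \<in> cball 0 R \<longrightarrow> G x = 0" for R :: real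
  proof -
    \<comment> \<open>\<open>f\<close> is the Caccioppoli integrand for the cutoff \<open>1\<close>, so \<open>fR\<close> lies below the integrand of every
      cutoff that equals \<open>1\<close> on the ball.\<close>
    define fR where "fR x = indicator (cball 0 R) x * f x" for x
    have [measurable]: "fR \<in> borel_measurable borel" unfolding fR_def by measurable
    have fR0: "0 \<le> fR x" for x using f0 by (simp add: fR_def)
    have main: "integrable lborel fR" "(\<integral>x. fR x \<partial>lborel) \<le> C p * real M powr (1 - p) + C q * real M powr (1 - q)"
      if M: "M > 0" "R \<le> 2 ^ M" for M :: nat
    proof -
      define F where "F x = (log_cutoff M x * inverse (u x + 1)) ^ Suc m * inverse (u x + 1) * norm (G x) powr p" for x
      note cac = caccioppoli[OF m log_cutoff_C1c(1) log_cutoff_bounds, of M]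
      have intF: "integrable lborel F" using cac(1) by (simp add: F_def[abs_def])
      have le: "fR x \<le> F x" for x
      proof (cases "x \<in> cball 0 R")
        case True
        then have "log_cutoff M x = 1" using M by (intro log_cutoff_eq_1) auto
        then show ?thesis using True by (simp add: fR_def f_def F_def)
      next
        case False
        then show ?thesis using upos[of x] log_cutoff_bounds(1)[of M x] by (simp add: fR_def F_def)
      qed
      show intfR: "integrable lborel fR"
        by (rule Bochner_Integration.integrable_bound[OF intF])
           (use le fR0 in \<open>auto intro!: AE_I2 intro: order_trans[OF _ abs_ge_self]\<close>)
      have "(\<integral>x. fR x \<partial>lborel) \<le> (\<integral>x. F x \<partial>lborel)"
        by (intro integral_mono intfR intF le)
      also have "\<dots> \<le> 2 powr p * (\<integral>x. norm (grad (log_cutoff M) (x::'a)) powr p \<partial>lborel)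
            + 2 powr q * (\<integral>x. norm (grad (log_cutoff M) (x::'a)) powr q \<partial>lborel)"
        using cac(2) by (simp add: F_def[abs_def])
      also have "\<dots> \<le> 2 powr p * ((16 powr p * 2 ^ DIM('a) * measure lborel (ball (0::'a) 1)) * real M powr (1 - p))
            + 2 powr q * ((16 powr q * 2 ^ DIM('a) * measure lborel (ball (0::'a) 1)) * real M powr (1 - q))"
        using dim pq M by (intro add_mono mult_left_mono integral_grad_log_cutoff_le) auto
      finally show "(\<integral>x. fR x \<partial>lborel) \<le> C p * real M powr (1 - p) + C q * real M powr (1 - q)"
        by (simp add: C_def mult.assoc)
    qed
    obtain M0 :: nat where M0: "R < 2 ^ M0" using real_arch_pow[of 2 R] by auto
    have large: "\<forall>\<^sub>F M in sequentially. M > 0 \<and> R \<le> 2 ^ M"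
      using eventually_gt_at_top[of "M0"]
    proof eventually_elim
      case (elim M)
      then have "(2::real) ^ M0 \<le> 2 ^ M" by (intro power_increasing) auto
      then have "R \<le> 2 ^ M" using M0 by linarith
      then show ?case using elim by simp
    qed
    have "((\<lambda>M::nat. C p * real M powr (1 - p) + C q * real M powr (1 - q)) \<longlongrightarrow> C p * 0 + C q * 0) sequentially"
      using pq by (intro tendsto_intros tendsto_neg_powr filterlim_real_sequentially) auto
    then have "(\<integral>x. fR x \<partial>lborel) \<le> C p * 0 + C q * 0"
      by (rule tendsto_lowerbound) (use large main(2) in \<open>auto elim!: eventually_mono\<close>)
    moreover have "0 \<le> (\<integral>x. fR x \<partial>lborel)" using fR0 by simp
    ultimately have "(\<integral>x. fR x \<partial>lborel) = 0" by simp
    moreover have "integrable lborel fR"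
    proof (rule main(1)[of "Suc M0"])
      have "(2::real) ^ M0 \<le> 2 ^ Suc M0" by simp
      then show "R \<le> 2 ^ Suc M0" using M0 by linarith
    qed simp
    ultimately have "AE x in lborel. fR x = 0"
      using integral_nonneg_eq_0_iff_AE[of lborel fR] fR0 by simp
    then show ?thesis
    proof eventually_elim
      case (elim x)
      then show ?case using upos[of x] pq by (auto simp: fR_def f_def)
    qed
  qed
  have "AE x in lborel. \<forall>n::nat. x \<in> cball 0 (real n) \<longrightarrow> G x = 0"
    unfolding AE_all_countable using ball by blast
  then show ?thesis
  proof eventually_elim
    case (elim x)
    obtain n :: nat where "norm x \<le> real n" using real_arch_simple by blast
    then show ?case using elim by auto
  qed
qed

text \<open>A mollification of \<open>u\<close> has gradient \<open>0\<close> and is constant, hence so is the pointwise limit \<open>u\<close>.\<close>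

lemma solution_constant:
  assumes dim: "q \<ge> real DIM('a)"
  shows "u x = u 0"
proof -
  obtain d and k :: "nat \<Rightarrow> 'a \<Rightarrow> real" where d: "d \<longlonglongrightarrow> 0" and k: "\<And>j. mollifier (d j) (k j)"
    using mollifier_sequence by blast
  have "mollify (k j) u x = mollify (k j) u 0" for j
  proof -
    have [measurable]: "k j \<in> borel_measurable borel" using mollifierD(7)[OF k] .
    have "mollify (k j) G y = 0" for y
      unfolding mollify_def
    proof (rule integral_eq_zero_AE)
      show "AE t in lborel. k j (y - t) *\<^sub>R G t = 0" using gradient_eq_0[OF dim] by eventually_elim simp
    qed
    then have "(mollify (k j) u has_derivative (\<lambda>h. 0)) (at y within UNIV)" for y
      using mollify_weak_gradient(1)[OF mollifierD(1)[OF k] u(1) wG, of j y] by (simp add: gderiv_def)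
    then obtain c where "\<And>y. mollify (k j) u y = c"
      using has_derivative_zero_constant[of UNIV "mollify (k j) u"] by auto
    then show ?thesis by simp
  qed
  then have "(\<lambda>j. mollify (k j) u 0) \<longlonglongrightarrow> u x"
    using mollify_tendsto[OF k u(1) d, of x] by simp
  then show ?thesis
    using mollify_tendsto[OF k u(1) d, of 0] by (rule LIMSEQ_unique)
qed

end

section \<open>From Lebesgue to Borel measurability\<close>

lemma borel_version:
  fixes G :: "'a::euclidean_space \<Rightarrow> 'b::euclidean_space"
  assumes "G \<in> borel_measurable lebesgue"
  obtains G' where "G' \<in> borel_measurable borel" "AE x in lebesgue. G x = G' x"
proof -
  have "\<exists>g\<in>borel_measurable lborel. AE x in lborel. G x \<bullet> b = g x" for b
    using assms by (intro completion_ex_borel_measurable_real borel_measurable_inner borel_measurable_const)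
  then obtain g where g: "\<And>b. g b \<in> borel_measurable lborel" "\<And>b. AE x in lborel. G x \<bullet> b = g b x"
    by metis
  have "AE x in lborel. \<forall>b\<in>Basis. G x \<bullet> b = g b x"
    using g(2) by (simp add: AE_finite_all)
  then have "AE x in lborel. G x = (\<Sum>b\<in>Basis. g b x *\<^sub>R b)"
  proof eventually_elim
    case (elim x)
    have "G x = (\<Sum>b\<in>Basis. (G x \<bullet> b) *\<^sub>R b)" by (simp add: euclidean_representation)
    also have "\<dots> = (\<Sum>b\<in>Basis. g b x *\<^sub>R b)" using elim by (intro sum.cong) auto
    finally show ?case .
  qed
  then have "AE x in lebesgue. G x = (\<Sum>b\<in>Basis. g b x *\<^sub>R b)" by (rule AE_completion)
  moreover have "(\<lambda>x. \<Sum>b\<in>Basis. g b x *\<^sub>R b) \<in> borel_measurable borel"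
    using g(1) by (auto intro!: borel_measurable_sum borel_measurable_scaleR)
  ultimately show ?thesis using that by blast
qed

lemma lebesgue_integral_cong_borel:
  fixes f g :: "'a::euclidean_space \<Rightarrow> 'b::euclidean_space"
  assumes f: "f \<in> borel_measurable lebesgue" and g: "g \<in> borel_measurable borel" and ae: "AE x in lebesgue. f x = g x"
  shows "(\<integral>x. f x \<partial>lebesgue) = (\<integral>x. g x \<partial>lborel)" and "integrable lebesgue f \<longleftrightarrow> integrable lborel g"
proof -
  have g': "g \<in> borel_measurable lborel" "g \<in> borel_measurable lebesgue"
    using g by (auto intro: measurable_completion)
  show "(\<integral>x. f x \<partial>lebesgue) = (\<integral>x. g x \<partial>lborel)"
    using integral_cong_AE[OF f g'(2) ae] integral_completion[OF g'(1)] by simp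
  show "integrable lebesgue f \<longleftrightarrow> integrable lborel g"
    using integrable_cong_AE[OF f g'(2) ae] integrable_completion[OF g'(1)] by simp
qed

lemma Lp_loc_borel:
  fixes G :: "'a::euclidean_space \<Rightarrow> 'a"
  assumes G: "G \<in> Lp_loc UNIV s" and G': "G' \<in> borel_measurable borel" "AE x in lebesgue. G x = G' x"
  shows "loc_integrable (\<lambda>x. norm (G' x) powr s)"
  unfolding loc_integrable_def
proof (intro conjI allI)
  have [measurable]: "G' \<in> borel_measurable borel" by (rule G')
  have [measurable]: "G \<in> borel_measurable lebesgue" using G by (simp add: Lp_loc_def lebesgue_on_UNIV_eq)
  show "(\<lambda>x. norm (G' x) powr s) \<in> borel_measurable borel" by measurable
  fix R :: real
  have "integrable lebesgue (\<lambda>x. indicator (cball 0 R) x *\<^sub>R (norm (G x) powr s))"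
    using G by (simp add: Lp_loc_def set_integrable_def)
  moreover have "AE x in lebesgue. indicator (cball 0 R) x *\<^sub>R (norm (G x) powr s) = indicator (cball 0 R) x *\<^sub>R (norm (G' x) powr s)"
    using G'(2) by eventually_elim simp
  ultimately show "integrable lborel (\<lambda>x. indicator (cball 0 R) x *\<^sub>R (norm (G' x) powr s))"
    by (subst lebesgue_integral_cong_borel(2)[symmetric]) (auto intro: borel_measurable_integrable)
qed

lemma has_weak_gradient_borel:
  fixes u :: "'a::euclidean_space \<Rightarrow> real"
  assumes u: "continuous_on UNIV u" and wG: "has_weak_gradient UNIV u G"
    and G': "G' \<in> borel_measurable borel" "AE x in lebesgue. G x = G' x"
  shows "weak_gradient u G'"
  unfolding weak_gradient_def
proof (intro conjI ballI)
  have [measurable]: "G' \<in> borel_measurable borel" by (rule G')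
  have G: "G \<in> Lp_loc UNIV 1" using wG by (simp add: has_weak_gradient_def)
  have [measurable]: "G \<in> borel_measurable lebesgue" using G by (simp add: Lp_loc_def lebesgue_on_UNIV_eq)
  show G'loc: "loc_integrable G'"
    by (rule loc_integrable_bound[OF Lp_loc_borel[OF G G']]) auto
  fix \<phi> :: "'a \<Rightarrow> real" assume \<phi>: "\<phi> \<in> C1c UNIV"
  note \<phi>D = C1cD[OF \<phi>]
  obtain R where R: "R > 0" "\<And>x. norm x > R \<Longrightarrow> \<phi> x = 0" "\<And>x. norm x > R \<Longrightarrow> grad \<phi> x = 0"
    using C1c_bounded_support[OF \<phi>] by blast
  have [measurable]: "u \<in> borel_measurable borel" "\<phi> \<in> borel_measurable borel" "grad \<phi> \<in> borel_measurable borel"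
    using u \<phi>D by (auto intro: borel_measurable_continuous_onI)
  have int1: "integrable lborel (\<lambda>x. u x *\<^sub>R grad \<phi> x)"
    by (rule integrable_continuous_compact_support[of _ R]) (auto intro!: continuous_intros u \<phi>D simp: R)
  have int2: "integrable lborel (\<lambda>x. \<phi> x *\<^sub>R G' x)"
    by (rule integrable_compact_support_mult[OF G'loc, of _ \<phi> R]) (auto intro!: \<phi>D simp: R mult.commute)
  show "(\<integral>x. u x *\<^sub>R grad \<phi> x \<partial>lborel) = - (\<integral>x. \<phi> x *\<^sub>R G' x \<partial>lborel)"
  proof (rule euclidean_eqI)
    fix b :: 'a assume b: "b \<in> Basis"
    have "(\<integral>x. u x *\<^sub>R grad \<phi> x \<partial>lborel) \<bullet> b = (\<integral>x. u x * (grad \<phi> x \<bullet> b) \<partial>lborel)"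
      using int1 by (subst integral_inner_left[symmetric]) auto
    also have "\<dots> = (\<integral>x. u x * (grad \<phi> x \<bullet> b) \<partial>lebesgue)"
      by (rule integral_completion[symmetric]) measurable
    also have "\<dots> = - (\<integral>x. (G x \<bullet> b) * \<phi> x \<partial>lebesgue)"
      using wG \<phi> b by (auto simp: has_weak_gradient_def set_lebesgue_integral_def)
    also have "(\<integral>x. (G x \<bullet> b) * \<phi> x \<partial>lebesgue) = (\<integral>x. (G' x \<bullet> b) * \<phi> x \<partial>lborel)"
    proof (rule lebesgue_integral_cong_borel(1))
      have "\<phi> \<in> borel_measurable lebesgue" by (rule measurable_completion) simp
      then show "(\<lambda>x. (G x \<bullet> b) * \<phi> x) \<in> borel_measurable lebesgue" by measurable
      show "AE x in lebesgue. (G x \<bullet> b) * \<phi> x = (G' x \<bullet> b) * \<phi> x" using G'(2) by eventually_elim simp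
    qed measurable
    also have "\<dots> = (\<integral>x. (\<phi> x *\<^sub>R G' x) \<bullet> b \<partial>lborel)" by (simp add: mult.commute)
    also have "\<dots> = (\<integral>x. \<phi> x *\<^sub>R G' x \<partial>lborel) \<bullet> b"
      using int2 by (subst integral_inner_left) auto
    finally show "(\<integral>x. u x *\<^sub>R grad \<phi> x \<partial>lborel) \<bullet> b = - (\<integral>x. \<phi> x *\<^sub>R G' x \<partial>lborel) \<bullet> b" by simp
  qed
qed

text \<open>Changing the gradient on a null set affects neither local integrability nor any of the integrals
  in the definition of a supersolution.\<close>

lemma supersolution_borel:
  fixes u :: "'a::euclidean_space \<Rightarrow> real"
  assumes pq: "p > q" "q > 1" and sup: "nonneg_supersolution UNIV p q u"
  obtains G where "borel_supersolution p q u G"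
proof -
  have u: "continuous_on UNIV u" "\<And>x. 0 \<le> u x" using sup by (auto simp: nonneg_supersolution_def)
  obtain G where G: "G \<in> Lp_loc UNIV p" "has_weak_gradient UNIV u G"
    and test: "\<And>\<phi>. \<phi> \<in> C1c UNIV \<Longrightarrow> (\<And>x. 0 \<le> \<phi> x) \<Longrightarrow>
      0 \<le> (\<integral>x. (norm (G x) powr (p - 2) *\<^sub>R G x) \<bullet> grad \<phi> x \<partial>lebesgue)
         + (\<integral>x. (norm (G x) powr (q - 2) *\<^sub>R G x) \<bullet> grad \<phi> x \<partial>lebesgue)"
    using sup by (auto simp: nonneg_supersolution_def set_lebesgue_integral_def)
  have Gm[measurable]: "G \<in> borel_measurable lebesgue" using G(1) by (simp add: Lp_loc_def lebesgue_on_UNIV_eq)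
  obtain G' where G'[measurable]: "G' \<in> borel_measurable borel" and ae: "AE x in lebesgue. G x = G' x"
    using borel_version[OF Gm] by blast
  have Gp: "loc_integrable (\<lambda>x. norm (G' x) powr p)" by (rule Lp_loc_borel[OF G(1) G' ae])
  have "borel_supersolution p q u G'"
  proof
    show "weak_gradient u G'" by (rule has_weak_gradient_borel[OF u(1) G(2) G' ae])
    fix \<phi> :: "'a \<Rightarrow> real" assume \<phi>: "\<phi> \<in> C1c UNIV" "\<And>x. 0 \<le> \<phi> x"
    note \<phi>D = C1cD[OF \<phi>(1)]
    obtain R where R: "R > 0" "\<And>x. norm x > R \<Longrightarrow> \<phi> x = 0" "\<And>x. norm x > R \<Longrightarrow> grad \<phi> x = 0"
      using C1c_bounded_support[OF \<phi>(1)] by blast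
    have [measurable]: "grad \<phi> \<in> borel_measurable borel"
      using \<phi>D by (auto intro: borel_measurable_continuous_onI)
    have m: "grad \<phi> \<in> borel_measurable lebesgue" by (rule measurable_completion) simp
    have eq: "(\<integral>x. (norm (G x) powr (r - 2) *\<^sub>R G x) \<bullet> grad \<phi> x \<partial>lebesgue)
        = (\<integral>x. (norm (G' x) powr (r - 2) *\<^sub>R G' x) \<bullet> grad \<phi> x \<partial>lborel)" for r
    proof (rule lebesgue_integral_cong_borel(1))
      show "(\<lambda>x. (norm (G x) powr (r - 2) *\<^sub>R G x) \<bullet> grad \<phi> x) \<in> borel_measurable lebesgue"
        using m by measurable
      show "AE x in lebesgue. (norm (G x) powr (r - 2) *\<^sub>R G x) \<bullet> grad \<phi> x = (norm (G' x) powr (r - 2) *\<^sub>R G' x) \<bullet> grad \<phi> x"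
        using ae by eventually_elim simp
    qed measurable
    have int: "integrable lborel (\<lambda>x. (norm (G' x) powr (r - 2) *\<^sub>R G' x) \<bullet> grad \<phi> x)" if "1 \<le> r" "r \<le> p" for r
    proof (rule integrable_compact_support_mult[of "\<lambda>x. norm (G' x) powr (r - 1)" _ "grad \<phi>" R])
      show "loc_integrable (\<lambda>x. norm (G' x) powr (r - 1))"
        using that by (intro loc_integrable_powr_le[OF G' Gp]) auto
      fix x
      have "norm ((norm (G' x) powr (r - 2) *\<^sub>R G' x) \<bullet> grad \<phi> x) \<le> norm (norm (G' x) powr (r - 2) *\<^sub>R G' x) * norm (grad \<phi> x)"
        unfolding real_norm_def by (rule Cauchy_Schwarz_ineq2)
      also have "norm (norm (G' x) powr (r - 2) *\<^sub>R G' x) = norm (G' x) powr (r - 1)"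
        using powr_mult_base[of "norm (G' x)" "r - 2"] by (simp add: mult.commute algebra_simps)
      finally show "norm ((norm (G' x) powr (r - 2) *\<^sub>R G' x) \<bullet> grad \<phi> x) \<le> norm (norm (G' x) powr (r - 1)) * norm (grad \<phi> x)"
        by simp
    qed (auto intro: \<phi>D simp: R)
    have "(\<integral>x. pq_flux p q (G' x) \<bullet> grad \<phi> x \<partial>lborel)
        = (\<integral>x. (norm (G' x) powr (p - 2) *\<^sub>R G' x) \<bullet> grad \<phi> x \<partial>lborel)
          + (\<integral>x. (norm (G' x) powr (q - 2) *\<^sub>R G' x) \<bullet> grad \<phi> x \<partial>lborel)"
      unfolding pq_flux_def inner_add_left using pq by (intro Bochner_Integration.integral_add int) auto
    then show "0 \<le> (\<integral>x. pq_flux p q (G' x) \<bullet> grad \<phi> x \<partial>lborel)"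
      using test[OF \<phi>] unfolding eq by simp
  qed (use pq u G' Gp in auto)
  then show ?thesis by (rule that)
qed

theorem theorem1p1:
  fixes u :: "real ^ 'n \<Rightarrow> real" and p q :: real
  assumes "p > q" and "q \<ge> real CARD('n)" and "q > 1"
    and "nonneg_supersolution UNIV p q u"
    and "\<exists>x. u x \<noteq> 0"
  shows "\<exists>c. \<forall>x. u x = c"
proof -
  obtain G where "borel_supersolution p q u G"
    using supersolution_borel[OF assms(1,3,4)] by blast
  then have "u x = u 0" for x
    using assms(2) by (intro borel_supersolution.solution_constant) simp_all
  then show ?thesis by blast
qed

end
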